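(* Let $f$ be a positive function on $(0,1)$ which is in the general case and such that the integral $\int_0^1 f(t)\,dt$ exists. For $x>0$ put $$U(x)=\int_0^1 f(t)\cos xt\,dt,\quad V(x)=\int_0^1 f(t)\sin xt\,dt,$$ $$U_s(x)=\int_0^1 f(1-t)\cos xt\,dt,\quad V_s(x)=\int_0^1 f(1-t)\sin xt\,dt.$$ (i) Suppose that $V_s(x)>0$ for all $x>0$. Then for each $k=1,2,\dots$, $U$ has exactly one zero in $\big((k-1/2)\pi,\,(k+1/2)\pi\big)$, and it is simple, and $V$ has exactly one zero in $\big(k\pi,\,(k+1)\pi\big)$, and it is simple. Moreover, $U$ and $V$ have no positive zeros elsewhere and share no common positive zeros. (ii) Suppose that $U_s(x)>0$ for all $x>0$. Then $U$ has exactly one zero, which is simple, in each of the intervals $\big(\pi/2,\,\pi\big)$ and $\big(k\pi,\,(k+1)\pi\big)$, $k=1,2,\dots$, and $V$ has at least one zero in each of the intervals $\big(\pi,\,3\pi/2\big)$ and $\big((k+1/2)\pi,\,(k+3/2)\pi\big)$, $k=1,2,\dots$. Moreover, $U$ and $V$ have no positive zeros elsewhere and share no common positive zeros. (iii) Suppose that $V_s(x)>0$ and $U_s(x)>0$ for all $x>0$. Then for each $k=1,2,\dots$, $U$ has exactly one zero in $\big((k-1/2)\pi,\,k\pi\big)$, and it is simple, and $V$ has exactly one zero in $\big(k\pi,\,(k+1/2)\pi\big)$, and it is simple. Moreover, $U$ and $V$ have no positive zeros elsewhere and share no common positive zeros.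
   Context: A function $f$ on $(0,1)$ is said to be in the exceptional case if there exist finitely many rational points $0=r_0<r_1<\cdots<r_N=1$ such that $f$ is constant on each open interval $(r_{k-1},r_k)$, $k=1,\dots,N$. Otherwise $f$ is said to be in the general case. *)

theory Defs
  imports "HOL-Analysis.Analysis"
begin

text \<open>
  A function on the open interval $(0,1)$ is a total function \<open>real \<Rightarrow> real\<close> whose values
  outside \<open>{0<..<1}\<close> are never used.
\<close>

definition exceptional_case :: "(real \<Rightarrow> real) \<Rightarrow> bool" where
  "exceptional_case f \<longleftrightarrow>
     (\<exists>(N::nat) (r :: nat \<Rightarrow> real).
        r 0 = 0 \<and> r N = 1 \<and>
        (\<forall>k\<in>{1..N}. r (k - 1) < r k) \<and>
        (\<forall>k\<le>N. r k \<in> \<rat>) \<and>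
        (\<forall>k\<in>{1..N}. f constant_on {r (k - 1)<..<r k}))"

definition general_case :: "(real \<Rightarrow> real) \<Rightarrow> bool" where
  "general_case f \<longleftrightarrow> \<not> exceptional_case f"

definition cos_integral :: "(real \<Rightarrow> real) \<Rightarrow> real \<Rightarrow> real" where
  "cos_integral f x = (LINT t:{0<..<1}|lebesgue. f t * cos (x * t))"

definition sin_integral :: "(real \<Rightarrow> real) \<Rightarrow> real \<Rightarrow> real" where
  "sin_integral f x = (LINT t:{0<..<1}|lebesgue. f t * sin (x * t))"

definition simple_zero :: "(real \<Rightarrow> real) \<Rightarrow> real \<Rightarrow> bool" where
  "simple_zero g x \<longleftrightarrow> g x = 0 \<and> (\<exists>D. D \<noteq> 0 \<and> (g has_real_derivative D) (at x))"

definition exactly_one_zero_simple :: "(real \<Rightarrow> real) \<Rightarrow> real set \<Rightarrow> bool" where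
  "exactly_one_zero_simple g I \<longleftrightarrow>
     (\<exists>!x. x \<in> I \<and> g x = 0) \<and> (\<forall>x\<in>I. g x = 0 \<longrightarrow> simple_zero g x)"

end

theory Submission
  imports Defs
begin

text \<open>
  The reflected transforms satisfy \<open>U\<^sub>s = cos x * U + sin x * V\<close> and \<open>V\<^sub>s = sin x * U - cos x * V\<close>,
  so their signs prescribe alternating signs of \<open>U\<close> and \<open>V\<close> at the multiples and the half-odd
  multiples of \<open>pi\<close>; this yields the existence and the location of the zeros. Uniqueness and
  simplicity come from sampling series. Expanding \<open>cos (x * t)\<close> in the orthogonal system
  \<open>cos (k * pi * t)\<close> on \<open>[0, 1]\<close> and integrating against \<open>f\<close> writes \<open>U x / sin x\<close> as a sum of
  terms \<open>(-1)^k * U (k * pi) * x / (x\<^sup>2 - (k * pi)\<^sup>2)\<close>, which all decrease between the nodes if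
  \<open>U\<^sub>s > 0\<close>. In the same way \<open>V x / sin x\<close> and \<open>U x / cos x\<close> are monotone between nodes if
  \<open>V\<^sub>s > 0\<close>. For the latter two only the difference of the expansions at two points converges
  absolutely, and this difference is all that monotonicity needs.
\<close>

subsection \<open>Expansions in trigonometric orthogonal systems on the unit interval\<close>

text \<open>The substitution \<open>s = cos (pi * t)\<close> maps [0, 1] homeomorphically onto
  [-1, 1] and the powers of the cosine to monomials. Weierstrass approximation of \<open>g\<close>
  in the variable \<open>s\<close> then bounds the integral of \<open>g t * g t\<close> by an
  arbitrarily small multiple of the integral of \<open>\<bar>g t\<bar>\<close>.\<close>

lemma continuous_orthogonal_cos_powers_eq_0:
  fixes g :: "real \<Rightarrow> real"
  assumes cont: "continuous_on {0..1} g"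
    and orth: "\<And>n::nat. integral {0..1} (\<lambda>t. g t * cos (pi * t) ^ n) = 0"
    and t: "t \<in> {0..1}"
  shows "g t = 0"
proof -
  define h where "h = (\<lambda>s. g (arccos s / pi))"
  have h_cos: "h (cos (pi * t)) = g t" if "t \<in> {0..1}" for t
    using that by (simp add: h_def arccos_cos)
  have "continuous_on {-1..1} (\<lambda>s. arccos s / pi)"
    by (intro continuous_intros) auto
  moreover have "(\<lambda>s. arccos s / pi) ` {-1..1} \<subseteq> {0..1}"
    by (auto simp: arccos_lbound arccos_ubound divide_le_eq)
  ultimately have h_cont: "continuous_on {-1..1} h"
    unfolding h_def using continuous_on_compose2[OF cont] by blast
  define J where "J = integral {0..1} (\<lambda>t. \<bar>g t\<bar>)"
  have J_nonneg: "0 \<le> J"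
    unfolding J_def by (rule integral_nonneg) (auto intro!: integrable_continuous_real continuous_intros cont)
  have bound: "integral {0..1} (\<lambda>t. g t * g t) \<le> \<epsilon> * J" if "\<epsilon> > 0" for \<epsilon>
  proof -
    obtain p where p: "real_polynomial_function p" "\<And>s. s \<in> {-1..1} \<Longrightarrow> \<bar>h s - p s\<bar> < \<epsilon>"
      using Stone_Weierstrass_real_polynomial_function[OF _ h_cont \<open>\<epsilon> > 0\<close>] by auto
    obtain a N where pa: "p = (\<lambda>x. \<Sum>i\<le>N. a i * x ^ i)"
      using p(1) unfolding real_polynomial_function_iff_sum by blast
    have pc: "continuous_on {0..1} (\<lambda>t. p (cos (pi * t)))"
      unfolding pa by (intro continuous_intros)
    have "integral {0..1} (\<lambda>t. g t * p (cos (pi * t))) =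
        integral {0..1} (\<lambda>t. \<Sum>i\<le>N. a i * (g t * cos (pi * t) ^ i))"
      by (simp add: pa sum_distrib_left mult_ac)
    also have "\<dots> = (\<Sum>i\<le>N. integral {0..1} (\<lambda>t. a i * (g t * cos (pi * t) ^ i)))"
      by (intro integral_sum integrable_continuous_real continuous_intros cont) auto
    also have "\<dots> = 0"
      by (simp add: orth)
    finally have zero: "integral {0..1} (\<lambda>t. g t * p (cos (pi * t))) = 0" .
    have "integral {0..1} (\<lambda>t. g t * g t) =
        integral {0..1} (\<lambda>t. g t * g t - g t * p (cos (pi * t)))"
      by (subst Henstock_Kurzweil_Integration.integral_diff)
         (auto intro!: integrable_continuous_real continuous_intros cont pc simp: zero)
    also have "\<dots> \<le> integral {0..1} (\<lambda>t. \<epsilon> * \<bar>g t\<bar>)"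
    proof (rule integral_le)
      fix t :: real assume t: "t \<in> {0..1}"
      have "g t * g t - g t * p (cos (pi * t)) \<le> \<bar>g t * (h (cos (pi * t)) - p (cos (pi * t)))\<bar>"
        unfolding h_cos[OF t] right_diff_distrib[symmetric] by (rule abs_ge_self)
      also have "\<dots> \<le> \<bar>g t\<bar> * \<epsilon>"
        unfolding abs_mult by (intro mult_left_mono less_imp_le[OF p(2)]) auto
      finally show "g t * g t - g t * p (cos (pi * t)) \<le> \<epsilon> * \<bar>g t\<bar>"
        by (simp add: mult.commute)
    qed (auto intro!: integrable_continuous_real continuous_intros cont pc)
    also have "\<dots> = \<epsilon> * J"
      by (simp add: J_def)
    finally show ?thesis .
  qed
  have "integral {0..1} (\<lambda>t. g t * g t) \<le> 0"
  proof (rule field_le_epsilon)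
    fix e :: real assume "e > 0"
    \<comment> \<open>Dividing by \<open>J + 1\<close> instead of \<open>J\<close> also covers
      \<open>J = 0\<close>.\<close>
    have "integral {0..1} (\<lambda>t. g t * g t) \<le> e / (J + 1) * J"
      using J_nonneg \<open>e > 0\<close> by (intro bound) auto
    also have "\<dots> \<le> e"
      using J_nonneg \<open>e > 0\<close> by (simp add: field_simps)
    finally show "integral {0..1} (\<lambda>t. g t * g t) \<le> 0 + e" by simp
  qed
  moreover have "integral {0..1} (\<lambda>t. g t * g t) \<ge> 0"
    by (rule integral_nonneg) (auto intro!: integrable_continuous_real continuous_intros cont)
  ultimately have "integral {0..1} (\<lambda>t. g t * g t) = 0" by simp
  moreover have "continuous_on {0..1} (\<lambda>t. g t * g t)"
    by (intro continuous_intros cont)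
  ultimately have "\<forall>t\<in>{0..1}. g t * g t = 0"
    using integral_eq_0_iff[of 0 1 "\<lambda>t. g t * g t"] by simp
  then show ?thesis using t by simp
qed

text \<open>
  Completeness of the system comes from \<open>rec\<close>: the span is stable under multiplication by
  \<open>cos (pi * t)\<close>, so a function orthogonal to all \<open>e k\<close>, multiplied by \<open>e 0\<close>, is orthogonal to
  all powers of \<open>cos (pi * t)\<close>.
\<close>

lemma orthogonal_expansion_sums:
  fixes e :: "nat \<Rightarrow> real \<Rightarrow> real" and K :: "real \<Rightarrow> real" and b :: "nat \<Rightarrow> real"
  assumes cont_e: "\<And>k. continuous_on {0..1} (e k)"
    and bound_e: "\<And>k t. \<bar>e k t\<bar> \<le> 1"
    and orth: "\<And>i j. i \<noteq> j \<Longrightarrow> integral {0..1} (\<lambda>t. e i t * e j t) = 0"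
    and rec: "\<And>k. \<exists>i j \<alpha> \<beta>. \<forall>t. cos (pi * t) * e k t = \<alpha> * e i t + \<beta> * e j t"
    and nz: "\<And>t. t \<in> {0<..<1} \<Longrightarrow> e 0 t \<noteq> 0"
    and cont_K: "continuous_on {0..1} K"
    and summ: "summable (\<lambda>k. \<bar>b k\<bar>)"
    and coeff: "\<And>k. integral {0..1} (\<lambda>t. K t * e k t) = b k * integral {0..1} (\<lambda>t. e k t * e k t)"
    and t: "t \<in> {0<..<1}"
  shows "(\<lambda>k. b k * e k t) sums K t"
proof -
  define S where "S = (\<lambda>t. \<Sum>k. b k * e k t)"
  have le: "norm (b k * e k t) \<le> \<bar>b k\<bar>" for k t
    using mult_left_mono[OF bound_e[of k t], of "\<bar>b k\<bar>"] by (simp add: abs_mult)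
  have lim: "uniform_limit {0..1} (\<lambda>n t. \<Sum>k<n. b k * e k t) S sequentially"
    unfolding S_def by (rule Weierstrass_m_test[OF _ summ]) (rule le)
  have cont_S: "continuous_on {0..1} S"
    by (rule uniform_limit_theorem[OF _ lim]) (auto intro!: always_eventually continuous_intros cont_e)
  \<comment> \<open>The defect \<open>c\<close> is orthogonal to every \<open>e m\<close>: uniform
    convergence allows integration of the partial sums against \<open>e m\<close>, and these
    integrals are constant as soon as \<open>n > m\<close>.\<close>
  define c where "c = (\<lambda>t. K t - S t)"
  have cont_c: "continuous_on {0..1} c"
    unfolding c_def by (intro continuous_intros cont_K cont_S)
  have c0: "integral {0..1} (\<lambda>t. c t * e m t) = 0" for m
  proof -
    have "uniform_limit {0..1} (\<lambda>n t. (\<Sum>k<n. b k * e k t) * e m t) (\<lambda>t. S t * e m t) sequentially"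
      by (rule uniform_lim_mult[OF lim uniform_limit_const])
         (auto intro!: compact_imp_bounded compact_continuous_image cont_S cont_e)
    then obtain I J where I: "\<And>n. ((\<lambda>t. (\<Sum>k<n. b k * e k t) * e m t) has_integral I n) {0..1}"
      and J: "((\<lambda>t. S t * e m t) has_integral J) {0..1}" and IJ: "I \<longlonglongrightarrow> J"
      by (rule uniform_limit_integral) (auto intro!: continuous_intros cont_e)
    have "I n = b m * integral {0..1} (\<lambda>t. e m t * e m t)" if "n > m" for n
    proof -
      have "I n = integral {0..1} (\<lambda>t. (\<Sum>k<n. b k * (e k t * e m t)))"
        using integral_unique[OF I[of n]] by (simp only: sum_distrib_right mult.assoc)
      also have "\<dots> = (\<Sum>k<n. b k * integral {0..1} (\<lambda>t. e k t * e m t))"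
        by (subst integral_sum) (auto intro!: integrable_continuous_real continuous_intros cont_e)
      also have "\<dots> = (\<Sum>k<n. if k = m then b m * integral {0..1} (\<lambda>t. e m t * e m t) else 0)"
        by (intro sum.cong) (auto simp: orth)
      also have "\<dots> = b m * integral {0..1} (\<lambda>t. e m t * e m t)"
        using that by simp
      finally show ?thesis .
    qed
    then have "I \<longlonglongrightarrow> b m * integral {0..1} (\<lambda>t. e m t * e m t)"
      by (intro tendsto_eventually eventually_mono[OF eventually_gt_at_top[of m]]) auto
    then have "J = b m * integral {0..1} (\<lambda>t. e m t * e m t)"
      using IJ LIMSEQ_unique by blast
    moreover have "integral {0..1} (\<lambda>t. c t * e m t) =
        integral {0..1} (\<lambda>t. K t * e m t) - integral {0..1} (\<lambda>t. S t * e m t)"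
      unfolding c_def left_diff_distrib
      by (subst Henstock_Kurzweil_Integration.integral_diff)
         (auto intro!: integrable_continuous_real continuous_intros cont_K cont_S cont_e)
    ultimately show ?thesis
      using integral_unique[OF J] by (simp add: coeff)
  qed
  \<comment> \<open>The induction on \<open>n\<close> must keep \<open>m\<close> arbitrary, because
    \<open>rec\<close> trades one cosine factor for a change of index.\<close>
  have "integral {0..1} (\<lambda>t. c t * e m t * cos (pi * t) ^ n) = 0" for m n
  proof (induction n arbitrary: m)
    case 0
    then show ?case by (simp add: c0)
  next
    case (Suc n)
    obtain i j \<alpha> \<beta> where r: "\<And>t. cos (pi * t) * e m t = \<alpha> * e i t + \<beta> * e j t"
      using rec[of m] by blast
    have "c t * e m t * cos (pi * t) ^ Suc n = c t * cos (pi * t) ^ n * (cos (pi * t) * e m t)" for t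
      by simp
    then have "integral {0..1} (\<lambda>t. c t * e m t * cos (pi * t) ^ Suc n) =
        integral {0..1} (\<lambda>t. \<alpha> * (c t * e i t * cos (pi * t) ^ n) + \<beta> * (c t * e j t * cos (pi * t) ^ n))"
      unfolding r by (simp add: algebra_simps)
    also have "\<dots> = 0"
      by (subst Henstock_Kurzweil_Integration.integral_add)
         (auto intro!: integrable_continuous_real continuous_intros cont_c cont_e simp: Suc)
    finally show ?case .
  qed
  then have "c t * e 0 t = 0"
    using t by (intro continuous_orthogonal_cos_powers_eq_0[of "\<lambda>t. c t * e 0 t"])
      (auto intro!: continuous_intros cont_c cont_e)
  then have "K t = S t"
    using nz[OF t] by (simp add: c_def)
  moreover have "summable (\<lambda>k. b k * e k t)"
    by (rule summable_comparison_test'[OF summ, of 0]) (rule le)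
  ultimately show ?thesis
    by (simp add: S_def summable_sums)
qed

text \<open>Termwise integration, justified by the majorant
  \<open>\<bar>b k\<bar> * \<bar>h t\<bar>\<close>. An expansion on the open interval is enough,
  because \<open>h\<close> vanishes elsewhere.\<close>

lemma integral_orthogonal_expansion_sums:
  fixes h :: "real \<Rightarrow> real" and e :: "nat \<Rightarrow> real \<Rightarrow> real"
  assumes h: "integrable lebesgue h" and supp: "\<And>t. t \<notin> {0<..<1} \<Longrightarrow> h t = 0"
    and e: "\<And>k. continuous_on UNIV (e k)" and bound_e: "\<And>k t. \<bar>e k t\<bar> \<le> 1"
    and summ: "summable (\<lambda>k. \<bar>b k\<bar>)"
    and sums: "\<And>t. t \<in> {0<..<1} \<Longrightarrow> (\<lambda>k. b k * e k t) sums K t"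
  shows "(\<lambda>k. b k * (LINT t|lebesgue. h t * e k t)) sums (LINT t|lebesgue. h t * K t)"
proof -
  note [measurable] = borel_measurable_integrable[OF h]
  have [measurable]: "e k \<in> borel_measurable lebesgue" for k
    by (rule measurable_completion) (simp add: borel_measurable_continuous_onI e)
  have le: "norm (b k * (h t * e k t)) \<le> \<bar>b k\<bar> * \<bar>h t\<bar>" for k t
    using mult_left_mono[OF bound_e[of k t], of "\<bar>b k\<bar> * \<bar>h t\<bar>"] by (simp add: abs_mult mult_ac)
  have int: "integrable lebesgue (\<lambda>t. b k * (h t * e k t))" for k
    by (rule Bochner_Integration.integrable_bound[where f="\<lambda>t. \<bar>b k\<bar> * \<bar>h t\<bar>"])
       (use h le in \<open>auto simp: abs_mult\<close>)
  have "(\<lambda>k. LINT t|lebesgue. b k * (h t * e k t)) sums (LINT t|lebesgue. (\<Sum>k. b k * (h t * e k t)))"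
  proof (rule sums_integral[OF int])
    have "summable (\<lambda>k. norm (b k * (h t * e k t)))" for t
      by (rule summable_comparison_test'[OF summable_mult2[OF summ], of 0 _ "\<bar>h t\<bar>"]) (use le in auto)
    then show "AE t in lebesgue. summable (\<lambda>k. norm (b k * (h t * e k t)))" by simp
    have "(LINT t|lebesgue. norm (b k * (h t * e k t))) \<le> (LINT t|lebesgue. \<bar>b k\<bar> * \<bar>h t\<bar>)" for k
      by (intro integral_mono le integrable_norm[OF int] integrable_mult_right integrable_abs h)
    then show "summable (\<lambda>k. LINT t|lebesgue. norm (b k * (h t * e k t)))"
      by (intro summable_comparison_test'[OF summable_mult2[OF summ], of 0 _ "LINT t|lebesgue. \<bar>h t\<bar>"])
         (auto simp: Bochner_Integration.integral_nonneg_AE)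
  qed
  also have "(\<lambda>t. \<Sum>k. b k * (h t * e k t)) = (\<lambda>t. h t * K t)"
  proof
    fix t
    show "(\<Sum>k. b k * (h t * e k t)) = h t * K t"
    proof (cases "t \<in> {0<..<1}")
      case True
      from sums_mult[OF sums[OF this], of "h t"] show ?thesis
        by (simp add: mult_ac sums_iff)
    qed (simp add: supp)
  qed
  finally show ?thesis by simp
qed

section \<open>Explicit integrals of products of cosines and of sines\<close>

text \<open>An explicit antiderivative gives the value. With both frequencies at nodes it yields
  orthogonality, with only \<open>a\<close> at a node it yields the expansion coefficients of the
  kernels.\<close>

lemma integral_cos_mult_cos:
  fixes a x :: real
  assumes "x\<^sup>2 \<noteq> a\<^sup>2"
  shows "integral {0..1} (\<lambda>t. cos (x * t) * cos (a * t)) =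
    (x * sin x * cos a - a * cos x * sin a) / (x\<^sup>2 - a\<^sup>2)"
proof -
  define F where "F = (\<lambda>t. (x * sin (x * t) * cos (a * t) - a * cos (x * t) * sin (a * t)) / (x\<^sup>2 - a\<^sup>2))"
  have "(F has_real_derivative cos (x * t) * cos (a * t)) (at t within {0..1})" for t
    unfolding F_def using assms
    by (auto intro!: derivative_eq_intros simp: divide_simps) (simp add: algebra_simps power2_eq_square)
  then have "((\<lambda>t. cos (x * t) * cos (a * t)) has_integral F 1 - F 0) {0..1}"
    by (intro fundamental_theorem_of_calculus) (auto simp: has_real_derivative_iff_has_vector_derivative)
  then show ?thesis by (simp add: F_def integral_unique)
qed

lemma integral_sin_mult_sin:
  fixes a x :: real
  assumes "x\<^sup>2 \<noteq> a\<^sup>2"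
  shows "integral {0..1} (\<lambda>t. sin (x * t) * sin (a * t)) =
    (a * sin x * cos a - x * cos x * sin a) / (x\<^sup>2 - a\<^sup>2)"
proof -
  define F where "F = (\<lambda>t. (a * sin (x * t) * cos (a * t) - x * cos (x * t) * sin (a * t)) / (x\<^sup>2 - a\<^sup>2))"
  have "(F has_real_derivative sin (x * t) * sin (a * t)) (at t within {0..1})" for t
    unfolding F_def using assms
    by (auto intro!: derivative_eq_intros simp: divide_simps) (simp add: algebra_simps power2_eq_square)
  then have "((\<lambda>t. sin (x * t) * sin (a * t)) has_integral F 1 - F 0) {0..1}"
    by (intro fundamental_theorem_of_calculus) (auto simp: has_real_derivative_iff_has_vector_derivative)
  then show ?thesis by (simp add: F_def integral_unique)
qed

text \<open>The condition \<open>sin a * cos a = 0\<close> treats multiples and half-odd multiples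
  of pi at once; it removes the boundary term of the antiderivative.\<close>

lemma integral_cos_squared:
  fixes a :: real
  assumes "a \<noteq> 0" "sin a * cos a = 0"
  shows "integral {0..1} (\<lambda>t. cos (a * t) * cos (a * t)) = 1 / 2"
proof -
  define F where "F = (\<lambda>t. t / 2 + sin (a * t) * cos (a * t) / (2 * a))"
  have "(F has_real_derivative cos (a * t) * cos (a * t)) (at t within {0..1})" for t
    unfolding F_def using assms(1)
    by (auto intro!: derivative_eq_intros simp: divide_simps)
       (use sin_cos_squared_add3[of "a * t"] in algebra)
  then have "((\<lambda>t. cos (a * t) * cos (a * t)) has_integral F 1 - F 0) {0..1}"
    by (intro fundamental_theorem_of_calculus) (auto simp: has_real_derivative_iff_has_vector_derivative)
  then show ?thesis using assms(2) by (simp add: F_def integral_unique)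
qed

lemma integral_sin_squared:
  fixes a :: real
  assumes "a \<noteq> 0" "sin a * cos a = 0"
  shows "integral {0..1} (\<lambda>t. sin (a * t) * sin (a * t)) = 1 / 2"
proof -
  define F where "F = (\<lambda>t. t / 2 - sin (a * t) * cos (a * t) / (2 * a))"
  have "(F has_real_derivative sin (a * t) * sin (a * t)) (at t within {0..1})" for t
    unfolding F_def using assms(1)
    by (auto intro!: derivative_eq_intros simp: divide_simps)
       (use sin_cos_squared_add3[of "a * t"] in algebra)
  then have "((\<lambda>t. sin (a * t) * sin (a * t)) has_integral F 1 - F 0) {0..1}"
    by (intro fundamental_theorem_of_calculus) (auto simp: has_real_derivative_iff_has_vector_derivative)
  then show ?thesis using assms(2) by (simp add: F_def integral_unique)
qed

text \<open>Once \<open>a k\<close> exceeds \<open>2 * x\<close> and \<open>2 * y\<close>, each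
  factor of the denominator has modulus at least half of \<open>(a k)\<^sup>2\<close>, so the terms
  are at most \<open>16 / (real k)\<^sup>2\<close>. The bound on \<open>c\<close> is asked only at
  nodes beyond \<open>x\<close> and \<open>y\<close>, where \<open>x * y\<close> and
  \<open>x + y\<close> can be estimated through \<open>a k\<close>.\<close>

lemma summable_node_coefficients:
  fixes a c :: "nat \<Rightarrow> real"
  assumes xy: "0 < x" "0 < y"
    and a: "\<And>k. real k \<le> a k"
    and c: "\<And>k. x \<le> a k \<Longrightarrow> y \<le> a k \<Longrightarrow> \<bar>c k\<bar> \<le> 4 * (a k)\<^sup>2"
  shows "summable (\<lambda>k. \<bar>c k / ((x\<^sup>2 - (a k)\<^sup>2) * (y\<^sup>2 - (a k)\<^sup>2))\<bar>)"
proof (rule summable_comparison_test')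
  show "summable (\<lambda>k. 16 * inverse (real k ^ 2))"
    by (intro summable_mult inverse_power_summable) simp
  fix k :: nat assume k: "nat \<lceil>2 * (x + y)\<rceil> + 1 \<le> k"
  have k': "2 * (x + y) \<le> real k" "0 < real k"
    using k by linarith+
  then have "2 * (x + y) \<le> a k"
    using a[of k] by linarith
  then have xa: "2 * x \<le> a k" "2 * y \<le> a k" and apos: "0 < a k"
    using xy by simp_all
  have sq: "(a k)\<^sup>2 / 2 \<le> \<bar>z\<^sup>2 - (a k)\<^sup>2\<bar>" if "0 < z" "2 * z \<le> a k" for z
  proof -
    have "(2 * z)\<^sup>2 \<le> (a k)\<^sup>2"
      using that by (intro power_mono) auto
    then have "4 * z\<^sup>2 \<le> (a k)\<^sup>2" by (simp add: power_mult_distrib)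
    moreover have "0 \<le> z\<^sup>2" by simp
    ultimately show ?thesis by linarith
  qed
  have "\<bar>c k\<bar> / (\<bar>x\<^sup>2 - (a k)\<^sup>2\<bar> * \<bar>y\<^sup>2 - (a k)\<^sup>2\<bar>) \<le> (4 * (a k)\<^sup>2) / ((a k)\<^sup>2 / 2 * ((a k)\<^sup>2 / 2))"
    using xa xy apos by (intro frac_le mult_mono sq c) auto
  also have "\<dots> = 16 / (a k)\<^sup>2"
    using apos by (simp add: field_simps)
  also have "\<dots> \<le> 16 / (real k)\<^sup>2"
    using k' a[of k] apos by (intro divide_left_mono power_mono mult_pos_pos) auto
  finally show "norm \<bar>c k / ((x\<^sup>2 - (a k)\<^sup>2) * (y\<^sup>2 - (a k)\<^sup>2))\<bar> \<le> 16 * inverse (real k ^ 2)"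
    by (simp add: abs_mult abs_divide divide_inverse)
qed

section \<open>Elementary facts about the nodes and product formulas\<close>

lemma sin_nonzero_imp_square_ne:
  fixes x :: real
  assumes "sin x \<noteq> 0"
  shows "x\<^sup>2 \<noteq> (real k * pi)\<^sup>2"
  using assms by (auto simp: power2_eq_iff)

lemma cos_half_odd_pi: "cos ((real k + 1/2) * pi) = 0"
  by (simp add: distrib_right cos_add)

lemma sin_half_odd_pi: "sin ((real k + 1/2) * pi) = (-1) ^ k"
  by (simp add: distrib_right sin_add)

lemma cos_nonzero_imp_square_ne:
  fixes x :: real
  assumes "cos x \<noteq> 0"
  shows "x\<^sup>2 \<noteq> ((real k + 1/2) * pi)\<^sup>2"
proof
  assume "x\<^sup>2 = ((real k + 1/2) * pi)\<^sup>2"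
  then consider "x = (real k + 1/2) * pi" | "x = - ((real k + 1/2) * pi)"
    unfolding power2_eq_iff by blast
  then show False
    using assms cos_half_odd_pi[of k] by cases (auto simp del: mult_minus_left)
qed

text \<open>The shape is that of the hypothesis \<open>rec\<close> of
  \<open>orthogonal_expansion_sums\<close>: with \<open>u = pi * t\<close> and
  \<open>v = a k * t\<close>, the arguments on the right belong to the neighbouring nodes.\<close>

lemma cos_times_cos_expand: "cos u * cos v = (1/2) * cos (v + u) + (1/2) * cos (v - u)" for u v :: real
  by (simp add: cos_add cos_diff field_simps)

lemma cos_times_sin_expand: "cos u * sin v = (1/2) * sin (v + u) + (1/2) * sin (v - u)" for u v :: real
  by (simp add: sin_add sin_diff field_simps)

lemma square_ne_of_pos_ne: "0 \<le> a \<Longrightarrow> 0 \<le> b \<Longrightarrow> a \<noteq> b \<Longrightarrow> a\<^sup>2 \<noteq> (b::real)\<^sup>2"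
  by (auto simp: power2_eq_iff)

lemma real_le_mult_pi: "real k \<le> real k * pi"
  using pi_ge_two by (simp add: mult_le_cancel_left1)

subsection \<open>Zeros from monotonicity between nodes\<close>

text \<open>Unlike \<open>exactly_one_zero_simple\<close>, this property passes to subsets of
  \<open>I\<close>. It can thus be proved on a whole cell between nodes and used on any part of the
  cell whose ends show a sign change.\<close>

definition at_most_one_zero_simple :: "(real \<Rightarrow> real) \<Rightarrow> real set \<Rightarrow> bool" where
  "at_most_one_zero_simple G I \<longleftrightarrow>
     (\<forall>x\<in>I. \<forall>y\<in>I. G x = 0 \<longrightarrow> G y = 0 \<longrightarrow> x = y) \<and> (\<forall>x\<in>I. G x = 0 \<longrightarrow> simple_zero G x)"

text \<open>The difference quotient of \<open>G / s\<close> is a sum of nonnegative terms, hence at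
  least its first term \<open>c 0 x y\<close>, which is positive. So \<open>G / s\<close> is
  strictly increasing on \<open>I\<close> and has at most one zero. As \<open>c 0\<close> is
  continuous on the diagonal, the same lower bound survives in the limit and keeps the derivative of
  \<open>G\<close> at a zero away from 0.\<close>

lemma at_most_one_zero_simple_of_sums:
  fixes G s :: "real \<Rightarrow> real" and c :: "nat \<Rightarrow> real \<Rightarrow> real \<Rightarrow> real"
  assumes I: "open I"
    and s: "continuous_on I s" "\<And>x. x \<in> I \<Longrightarrow> s x \<noteq> 0"
    and G: "\<And>x. x \<in> I \<Longrightarrow> \<exists>D. (G has_real_derivative D) (at x)"
    and sums: "\<And>x y. x \<in> I \<Longrightarrow> y \<in> I \<Longrightarrow> (\<lambda>k. (x - y) * c k x y) sums (G x / s x - G y / s y)"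
    and nonneg: "\<And>k x y. x \<in> I \<Longrightarrow> y \<in> I \<Longrightarrow> 0 \<le> c k x y"
    and pos: "\<And>x y. x \<in> I \<Longrightarrow> y \<in> I \<Longrightarrow> 0 < c 0 x y"
    and cont: "\<And>y. y \<in> I \<Longrightarrow> isCont (\<lambda>x. c 0 x y) y"
  shows "at_most_one_zero_simple G I"
proof -
  have slope: "c 0 x y \<le> (G x / s x - G y / s y) / (x - y)" if "x \<in> I" "y \<in> I" "x \<noteq> y" for x y
  proof -
    have total: "(\<lambda>k. c k x y) sums ((G x / s x - G y / s y) / (x - y))"
      using sums_divide[OF sums[OF that(1,2)], of "x - y"] that(3) by simp
    have first: "(\<lambda>k. if k = 0 then c 0 x y else 0) sums c 0 x y"
      by (rule sums_single)
    show ?thesis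
      by (rule sums_le[OF _ first total]) (simp add: nonneg that(1,2))
  qed
  have "x = y" if "x \<in> I" "y \<in> I" "G x = 0" "G y = 0" for x y
    using slope[of x y] pos[of x y] that by force
  moreover have "simple_zero G y" if y: "y \<in> I" "G y = 0" for y
  proof -
    obtain D where D: "(G has_real_derivative D) (at y)"
      using G y(1) by blast
    have "((\<lambda>x. \<bar>(G x - G y) / (x - y)\<bar>) \<longlongrightarrow> \<bar>D\<bar>) (at y)"
      using D unfolding has_field_derivative_iff by (rule tendsto_rabs)
    moreover have "isCont s y"
      using s(1) I y(1) by (simp add: continuous_on_eq_continuous_at)
    then have "((\<lambda>x. \<bar>s x\<bar> * c 0 x y) \<longlongrightarrow> \<bar>s y\<bar> * c 0 y y) (at y)"
      using cont[OF y(1)] by (auto intro!: tendsto_intros simp: isCont_def)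
    \<comment> \<open>Since \<open>G y = 0\<close>, multiplying the slope of \<open>G / s\<close> by
      \<open>s x\<close> gives the difference quotient of \<open>G\<close> itself, so continuity of
      \<open>s\<close> suffices.\<close>
    moreover have "\<forall>\<^sub>F x in at y. \<bar>s x\<bar> * c 0 x y \<le> \<bar>(G x - G y) / (x - y)\<bar>"
      using eventually_at_in_open[OF I y(1)]
    proof eventually_elim
      case (elim x)
      have "c 0 x y \<le> \<bar>G x / s x / (x - y)\<bar>"
        using slope[of x y] elim y by (intro order_trans[OF _ abs_ge_self]) auto
      then have "\<bar>s x\<bar> * c 0 x y \<le> \<bar>s x\<bar> * \<bar>G x / s x / (x - y)\<bar>"
        by (rule mult_left_mono) simp
      also have "\<dots> = \<bar>(G x - G y) / (x - y)\<bar>"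
        using elim y s(2)[of x] by (simp add: abs_mult abs_divide)
      finally show ?case .
    qed
    ultimately have "\<bar>s y\<bar> * c 0 y y \<le> \<bar>D\<bar>"
      by (intro tendsto_le[where F="at y"]) auto
    moreover have "0 < \<bar>s y\<bar> * c 0 y y"
      using s(2) pos y by simp
    ultimately have "D \<noteq> 0"
      by linarith
    then show ?thesis
      using D y(2) unfolding simple_zero_def by blast
  qed
  ultimately show ?thesis
    unfolding at_most_one_zero_simple_def by blast
qed

lemma zero_of_sign_change:
  fixes G :: "real \<Rightarrow> real"
  assumes "p < q" and cont: "\<And>x. p \<le> x \<Longrightarrow> x \<le> q \<Longrightarrow> isCont G x" and sign: "G p * G q < 0"
  shows "\<exists>x\<in>{p<..<q}. G x = 0"
proof -
  have *: "\<exists>x\<in>{p<..<q}. F x = 0"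
    if "F p < 0" "0 < F q" "\<And>x. p \<le> x \<Longrightarrow> x \<le> q \<Longrightarrow> isCont F x" for F :: "real \<Rightarrow> real"
  proof -
    have "\<exists>x\<ge>p. x \<le> q \<and> F x = 0"
      using that \<open>p < q\<close> by (intro IVT) auto
    then obtain x where "p \<le> x" "x \<le> q" "F x = 0" by blast
    then show ?thesis
      using that by (intro bexI[of _ x]) (auto simp: less_le)
  qed
  show ?thesis
    using sign *[of G] *[of "\<lambda>x. - G x"] cont by (auto simp: mult_less_0_iff)
qed

lemma alternating_product_neg:
  fixes a b :: real
  assumes "0 < (-1) ^ k * a" "0 < (-1) ^ Suc k * b"
  shows "a * b < 0"
  using assms by (cases "even k") (auto simp: mult_less_0_iff)

text \<open>Existence and uniqueness may refer to different intervals: the sign change is tested at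
  the ends of a possibly smaller interval inside \<open>I\<close>.\<close>

lemma exactly_one_zero_simpleI:
  assumes "at_most_one_zero_simple G I" "{p<..<q} \<subseteq> I" "p < q"
    and "\<And>x. p \<le> x \<Longrightarrow> x \<le> q \<Longrightarrow> isCont G x" "G p * G q < 0"
  shows "exactly_one_zero_simple G {p<..<q}"
  using zero_of_sign_change[of p q G] assms
  unfolding exactly_one_zero_simple_def at_most_one_zero_simple_def by blast

section \<open>Cells between consecutive nodes\<close>

text \<open>With no node between them, \<open>x\<close> and \<open>y\<close> lie on the same side of
  \<open>a\<close>, so the two factors agree in sign. This gives all denominators of the sampling
  series the same sign.\<close>

lemma node_product_pos:
  fixes a :: real
  assumes "0 \<le> l" "0 \<le> a" "a \<notin> {l<..<r}" "x \<in> {l<..<r}" "y \<in> {l<..<r}"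
  shows "0 < (x\<^sup>2 - a\<^sup>2) * (y\<^sup>2 - a\<^sup>2)"
proof (cases "a \<le> l")
  case True
  then have "a\<^sup>2 < x\<^sup>2" "a\<^sup>2 < y\<^sup>2"
    using assms by (auto intro!: power_strict_mono)
  then show ?thesis by simp
next
  case False
  then have "x\<^sup>2 < a\<^sup>2" "y\<^sup>2 < a\<^sup>2"
    using assms by (auto intro!: power_strict_mono)
  then show ?thesis by (intro mult_neg_neg) auto
qed

text \<open>The shift \<open>d\<close> is 0 for multiples of pi and 1/2 for half-odd
  multiples.\<close>

lemma pi_multiple_notin_cell:
  "(real j + d) * pi \<notin> {(real k + d) * pi<..<(real k + d + 1) * pi}"
proof (cases "j \<le> k")
  case True
  then have "(real j + d) * pi \<le> (real k + d) * pi"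
    by (intro mult_right_mono) auto
  then show ?thesis by simp
next
  case False
  then have "real (Suc k) \<le> real j"
    unfolding of_nat_le_iff by simp
  then have "(real k + d + 1) * pi \<le> (real j + d) * pi"
    by (intro mult_right_mono) auto
  then show ?thesis by simp
qed

text \<open>The index is the floor of \<open>x / pi - d\<close>; excluding the nodes makes the left
  inequality strict. The shift \<open>d\<close> marks where the first cell begins.\<close>

lemma in_pi_cell:
  assumes "d * pi < x" "\<And>k::nat. x \<noteq> (real k + d) * pi"
  shows "\<exists>k::nat. x \<in> {(real k + d) * pi<..<(real k + d + 1) * pi}"
proof
  define k where "k = nat \<lfloor>x / pi - d\<rfloor>"
  have "0 < x / pi - d" using assms(1) by (simp add: field_simps)
  then have "real k \<le> x / pi - d" "x / pi - d < real k + 1"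
    unfolding k_def by linarith+
  then have "(real k + d) * pi \<le> x" "x < (real k + d + 1) * pi"
    by (simp_all add: field_simps)
  then show "x \<in> {(real k + d) * pi<..<(real k + d + 1) * pi}"
    using assms(2)[of k] by auto
qed

lemma sin_nonzero_in_cell:
  assumes "x \<in> {real k * pi<..<(real k + 1) * pi}"
  shows "sin x \<noteq> 0"
proof
  assume "sin x = 0"
  then obtain i :: int where i: "x = of_int i * pi"
    unfolding sin_zero_iff_int2 by blast
  then have "of_int (int k) < (of_int i :: real)" "of_int i < (of_int (int k + 1) :: real)"
    using assms by auto
  then show False unfolding of_int_less_iff by linarith
qed

lemma cos_nonzero_in_cell:
  assumes "x \<in> {(real k + 1/2) * pi<..<(real k + 1/2 + 1) * pi}"
  shows "cos x \<noteq> 0"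
proof -
  have "sin (x - pi / 2) \<noteq> 0"
    using assms by (intro sin_nonzero_in_cell[where k=k]) (auto simp: algebra_simps)
  then show ?thesis by (simp add: sin_diff)
qed

subsection \<open>Cosine and sine transforms\<close>

context
  fixes h :: "real \<Rightarrow> real"
  assumes h: "integrable lebesgue h" and supp: "\<And>t. t \<notin> {0<..<1} \<Longrightarrow> h t = 0"
begin

lemma integrable_mult_bounded:
  assumes "continuous_on UNIV e" "\<And>t. \<bar>e t\<bar> \<le> (B::real)"
  shows "integrable lebesgue (\<lambda>t. h t * e t)"
proof -
  note [measurable] = borel_measurable_integrable[OF h]
  have [measurable]: "e \<in> borel_measurable lebesgue"
    by (rule measurable_completion) (simp add: borel_measurable_continuous_onI assms)
  have "\<bar>h t\<bar> * \<bar>e t\<bar> \<le> \<bar>h t\<bar> * \<bar>B\<bar>" for t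
    using assms(2)[of t] by (intro mult_left_mono) auto
  then show ?thesis
    by (intro Bochner_Integration.integrable_bound[where f="\<lambda>t. h t * B" and g="\<lambda>t. h t * e t"])
       (use h in \<open>auto simp: abs_mult\<close>)
qed

lemma integrable_cos: "integrable lebesgue (\<lambda>t. h t * cos (x * t))"
  by (rule integrable_mult_bounded[where B=1]) (auto intro!: continuous_intros)

lemma integrable_sin: "integrable lebesgue (\<lambda>t. h t * sin (x * t))"
  by (rule integrable_mult_bounded[where B=1]) (auto intro!: continuous_intros)

section \<open>Sampling series of the transforms\<close>

text \<open>The kernel \<open>cos (x * t) / sin x - cos (y * t) / sin y\<close> is expanded in the
  functions \<open>cos (real k * pi * t)\<close> and the expansion is integrated against
  \<open>h\<close>. Combining the two fractions of each coefficient exposes the common factor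
  \<open>y - x\<close>.\<close>

lemma cos_transform_sampling_integers:
  assumes xy: "0 < x" "0 < y" and sin_nz: "sin x \<noteq> 0" "sin y \<noteq> 0"
  shows "(\<lambda>k. (y - x) * ((if k = 0 then 1 else 2) * (x * y + (real k * pi)\<^sup>2) /
           ((x\<^sup>2 - (real k * pi)\<^sup>2) * (y\<^sup>2 - (real k * pi)\<^sup>2)) *
           ((-1) ^ k * (LINT t|lebesgue. h t * cos (real k * pi * t)))))
    sums ((LINT t|lebesgue. h t * cos (x * t)) / sin x - (LINT t|lebesgue. h t * cos (y * t)) / sin y)"
proof -
  define a where "a = (\<lambda>k. real k * pi)"
  define K where "K = (\<lambda>t. cos (x * t) / sin x - cos (y * t) / sin y)"
  \<comment> \<open>The factors 1 and 2 are the reciprocals of the squared norms: 1 for the constant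
    function and 1/2 for every other cosine.\<close>
  define c where "c = (\<lambda>k. (if k = 0 then 1 else 2) * (x * y + (a k)\<^sup>2) / ((x\<^sup>2 - (a k)\<^sup>2) * (y\<^sup>2 - (a k)\<^sup>2)))"
  define b where "b = (\<lambda>k. (y - x) * (c k * (-1) ^ k))"
  have ne: "x\<^sup>2 \<noteq> (a k)\<^sup>2" "y\<^sup>2 \<noteq> (a k)\<^sup>2" for k
    using sin_nonzero_imp_square_ne sin_nz by (auto simp: a_def)
  have cos_a: "cos (a k) = (-1) ^ k" and sin_a: "sin (a k) = 0" for k
    by (simp_all add: a_def)
  have orth: "integral {0..1} (\<lambda>t. cos (a i * t) * cos (a j * t)) = 0" if "i \<noteq> j" for i j
    using that by (subst integral_cos_mult_cos) (auto intro!: square_ne_of_pos_ne simp: a_def)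
  have nrm: "integral {0..1} (\<lambda>t. cos (a k * t) * cos (a k * t)) = (if k = 0 then 1 else 1 / 2)" for k
    using integral_cos_squared[of "a k"] by (auto simp: a_def)
  have rec: "\<exists>i j \<alpha> \<beta>. \<forall>t. cos (pi * t) * cos (a k * t) = \<alpha> * cos (a i * t) + \<beta> * cos (a j * t)" for k
  proof (cases k)
    case 0
    then show ?thesis
      by (intro exI[of _ 1] exI[of _ 1] exI[of _ 1] exI[of _ 0]) (simp add: a_def)
  next
    case (Suc m)
    have "a k * t + pi * t = a (k + 1) * t" "a k * t - pi * t = a m * t" for t
      by (simp_all add: a_def Suc algebra_simps)
    then show ?thesis
      using cos_times_cos_expand[of "pi * t" "a k * t" for t] by metis
  qed
  have c_summ: "summable (\<lambda>k. \<bar>c k\<bar>)"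
    unfolding c_def
  proof (rule summable_node_coefficients[OF xy])
    show "real k \<le> a k" for k by (simp add: a_def real_le_mult_pi)
    fix k assume "x \<le> a k" "y \<le> a k"
    then have "x * y \<le> a k * a k" using xy by (intro mult_mono) auto
    moreover have "0 \<le> x * y" using xy by simp
    ultimately show "\<bar>(if k = 0 then 1 else 2) * (x * y + (a k)\<^sup>2)\<bar> \<le> 4 * (a k)\<^sup>2"
      by (auto simp: power2_eq_square abs_mult)
  qed
  have summ: "summable (\<lambda>k. \<bar>b k\<bar>)"
    unfolding b_def abs_mult power_abs using c_summ by simp
  have coeff: "integral {0..1} (\<lambda>t. K t * cos (a k * t)) =
      b k * integral {0..1} (\<lambda>t. cos (a k * t) * cos (a k * t))" for k
  proof -
    have "integral {0..1} (\<lambda>t. K t * cos (a k * t)) =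
        integral {0..1} (\<lambda>t. inverse (sin x) * (cos (x * t) * cos (a k * t)) -
          inverse (sin y) * (cos (y * t) * cos (a k * t)))"
      by (simp add: K_def divide_inverse algebra_simps)
    also have "\<dots> = inverse (sin x) * (x * sin x * cos (a k) / (x\<^sup>2 - (a k)\<^sup>2)) -
        inverse (sin y) * (y * sin y * cos (a k) / (y\<^sup>2 - (a k)\<^sup>2))"
      by (subst Henstock_Kurzweil_Integration.integral_diff)
         (auto intro!: integrable_continuous_real continuous_intros
           simp: integral_cos_mult_cos[OF ne(1)] integral_cos_mult_cos[OF ne(2)] sin_a)
    also have "\<dots> = (-1) ^ k * (x / (x\<^sup>2 - (a k)\<^sup>2) - y / (y\<^sup>2 - (a k)\<^sup>2))"
      using sin_nz by (simp add: cos_a field_simps)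
    also have "x / (x\<^sup>2 - (a k)\<^sup>2) - y / (y\<^sup>2 - (a k)\<^sup>2) =
        (y - x) * ((x * y + (a k)\<^sup>2) / ((x\<^sup>2 - (a k)\<^sup>2) * (y\<^sup>2 - (a k)\<^sup>2)))"
      using ne[of k] by (simp add: divide_simps) (simp add: algebra_simps power2_eq_square)
    finally show ?thesis
      by (simp add: nrm b_def c_def)
  qed
  have "(\<lambda>k. b k * cos (a k * t)) sums K t" if "t \<in> {0<..<1}" for t
    using that
    by (intro orthogonal_expansion_sums[where e="\<lambda>k t. cos (a k * t)"] orth rec summ coeff)
       (auto simp: K_def a_def sin_nz intro!: continuous_intros)
  then have "(\<lambda>k. b k * (LINT t|lebesgue. h t * cos (a k * t))) sums (LINT t|lebesgue. h t * K t)"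
    by (intro integral_orthogonal_expansion_sums[OF h] supp summ) (auto intro!: continuous_intros)
  also have "(LINT t|lebesgue. h t * K t) =
      (LINT t|lebesgue. h t * cos (x * t)) / sin x - (LINT t|lebesgue. h t * cos (y * t)) / sin y"
    by (simp add: K_def right_diff_distrib integrable_cos integrable_sin)
  finally show ?thesis
    by (simp add: b_def c_def a_def mult_ac)
qed

text \<open>The sine system starts at frequency pi, so index \<open>k\<close> belongs to the node
  \<open>real (Suc k) * pi\<close>. The coefficients of \<open>sin (x * t) / sin x\<close> alone
  decay only like \<open>1 / k\<close>; subtracting the same kernel at \<open>y\<close> makes them
  absolutely summable.\<close>

lemma sin_transform_sampling_integers:
  assumes xy: "0 < x" "0 < y" and sin_nz: "sin x \<noteq> 0" "sin y \<noteq> 0"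
  shows "(\<lambda>k. (x - y) * (2 * (real (Suc k) * pi) * (x + y) /
           ((x\<^sup>2 - (real (Suc k) * pi)\<^sup>2) * (y\<^sup>2 - (real (Suc k) * pi)\<^sup>2)) *
           ((-1) ^ k * (LINT t|lebesgue. h t * sin (real (Suc k) * pi * t)))))
    sums ((LINT t|lebesgue. h t * sin (x * t)) / sin x - (LINT t|lebesgue. h t * sin (y * t)) / sin y)"
proof -
  define a where "a = (\<lambda>k. real (Suc k) * pi)"
  define K where "K = (\<lambda>t. sin (x * t) / sin x - sin (y * t) / sin y)"
  define c where "c = (\<lambda>k. 2 * a k * (x + y) / ((x\<^sup>2 - (a k)\<^sup>2) * (y\<^sup>2 - (a k)\<^sup>2)))"
  define b where "b = (\<lambda>k. (x - y) * (c k * (-1) ^ k))"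
  have ne: "x\<^sup>2 \<noteq> (a k)\<^sup>2" "y\<^sup>2 \<noteq> (a k)\<^sup>2" for k
    unfolding a_def using sin_nonzero_imp_square_ne sin_nz by blast+
  have cos_a: "cos (a k) = - ((-1) ^ k)" and sin_a: "sin (a k) = 0" for k
    unfolding a_def cos_npi sin_npi by simp_all
  have a_pos: "0 < a k" and a_inj: "a i = a j \<longleftrightarrow> i = j" for i j k
    unfolding a_def by simp_all
  have orth: "integral {0..1} (\<lambda>t. sin (a i * t) * sin (a j * t)) = 0" if "i \<noteq> j" for i j
    using that a_inj a_pos[THEN less_imp_le]
    by (subst integral_sin_mult_sin) (auto intro!: square_ne_of_pos_ne simp: sin_a)
  have nrm: "integral {0..1} (\<lambda>t. sin (a k * t) * sin (a k * t)) = 1 / 2" for k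
    using integral_sin_squared[of "a k"] a_pos[of k] by (auto simp: sin_a)
  have rec: "\<exists>i j \<alpha> \<beta>. \<forall>t. cos (pi * t) * sin (a k * t) = \<alpha> * sin (a i * t) + \<beta> * sin (a j * t)" for k
  proof (cases k)
    case 0
    \<comment> \<open>The lower neighbour of the first node is 0, where the sine function vanishes
      identically; the second summand gets coefficient 0.\<close>
    have "a k * t + pi * t = a 1 * t" "sin (a k * t - pi * t) = 0" for t
      by (simp_all add: a_def 0)
    then have "cos (pi * t) * sin (a k * t) = (1/2) * sin (a 1 * t) + 0 * sin (a 1 * t)" for t
      using cos_times_sin_expand[of "pi * t" "a k * t"] by simp
    then show ?thesis by blast
  next
    case (Suc m)
    have "a k * t + pi * t = a (k + 1) * t" "a k * t - pi * t = a m * t" for t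
      by (simp_all add: a_def Suc algebra_simps)
    then show ?thesis
      using cos_times_sin_expand[of "pi * t" "a k * t" for t] by metis
  qed
  have c_summ: "summable (\<lambda>k. \<bar>c k\<bar>)"
    unfolding c_def
  proof (rule summable_node_coefficients[OF xy])
    show "real k \<le> a k" for k
      unfolding a_def by (rule order_trans[OF _ real_le_mult_pi]) simp
    fix k assume "x \<le> a k" "y \<le> a k"
    then have "2 * a k * (x + y) \<le> 2 * a k * (2 * a k)" using a_pos[of k] by (intro mult_left_mono) auto
    moreover have "0 \<le> 2 * a k * (x + y)" using xy a_pos[of k] by simp
    ultimately show "\<bar>2 * a k * (x + y)\<bar> \<le> 4 * (a k)\<^sup>2"
      by (simp add: power2_eq_square)
  qed
  have summ: "summable (\<lambda>k. \<bar>b k\<bar>)"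
    unfolding b_def abs_mult power_abs using c_summ by simp
  have coeff: "integral {0..1} (\<lambda>t. K t * sin (a k * t)) =
      b k * integral {0..1} (\<lambda>t. sin (a k * t) * sin (a k * t))" for k
  proof -
    have "integral {0..1} (\<lambda>t. K t * sin (a k * t)) =
        integral {0..1} (\<lambda>t. inverse (sin x) * (sin (x * t) * sin (a k * t)) -
          inverse (sin y) * (sin (y * t) * sin (a k * t)))"
      by (simp add: K_def divide_inverse algebra_simps)
    also have "\<dots> = inverse (sin x) * (a k * sin x * cos (a k) / (x\<^sup>2 - (a k)\<^sup>2)) -
        inverse (sin y) * (a k * sin y * cos (a k) / (y\<^sup>2 - (a k)\<^sup>2))"
      by (subst Henstock_Kurzweil_Integration.integral_diff)
         (auto intro!: integrable_continuous_real continuous_intros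
           simp: integral_sin_mult_sin[OF ne(1)] integral_sin_mult_sin[OF ne(2)] sin_a)
    also have "\<dots> = - ((-1) ^ k) * a k * (1 / (x\<^sup>2 - (a k)\<^sup>2) - 1 / (y\<^sup>2 - (a k)\<^sup>2))"
      using sin_nz by (simp add: cos_a field_simps)
    also have "1 / (x\<^sup>2 - (a k)\<^sup>2) - 1 / (y\<^sup>2 - (a k)\<^sup>2) =
        - ((x - y) * (x + y) / ((x\<^sup>2 - (a k)\<^sup>2) * (y\<^sup>2 - (a k)\<^sup>2)))"
      using ne[of k] by (simp add: divide_simps) (simp add: algebra_simps power2_eq_square)
    finally show ?thesis
      by (simp add: nrm b_def c_def)
  qed
  \<comment> \<open>The first basis function vanishes at both ends of [0, 1], which is why the
    expansion is claimed on the open interval.\<close>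
  have "sin (a 0 * t) \<noteq> 0" if "t \<in> {0<..<1}" for t
  proof -
    have "0 < sin (a 0 * t)"
      using that by (intro sin_gt_zero) (auto simp: a_def)
    then show ?thesis by simp
  qed
  then have "(\<lambda>k. b k * sin (a k * t)) sums K t" if "t \<in> {0<..<1}" for t
    using that
    by (intro orthogonal_expansion_sums[where e="\<lambda>k t. sin (a k * t)"] orth rec summ coeff)
       (auto simp: K_def sin_nz intro!: continuous_intros)
  then have "(\<lambda>k. b k * (LINT t|lebesgue. h t * sin (a k * t))) sums (LINT t|lebesgue. h t * K t)"
    by (intro integral_orthogonal_expansion_sums[OF h] supp summ) (auto intro!: continuous_intros)
  also have "(LINT t|lebesgue. h t * K t) =
      (LINT t|lebesgue. h t * sin (x * t)) / sin x - (LINT t|lebesgue. h t * sin (y * t)) / sin y"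
    by (simp add: K_def right_diff_distrib integrable_cos integrable_sin)
  finally show ?thesis
    by (simp only: b_def c_def a_def mult_ac)
qed

text \<open>At half-odd multiples of pi the cosine vanishes, so in the coefficients only the term
  with \<open>cos x * sin a\<close> remains and division by \<open>cos x\<close> clears it. As for
  the sine series, the difference at two points secures absolute convergence.\<close>

lemma cos_transform_sampling_half_integers:
  assumes xy: "0 < x" "0 < y" and cos_nz: "cos x \<noteq> 0" "cos y \<noteq> 0"
  shows "(\<lambda>k. (x - y) * (2 * ((real k + 1/2) * pi) * (x + y) /
           ((x\<^sup>2 - ((real k + 1/2) * pi)\<^sup>2) * (y\<^sup>2 - ((real k + 1/2) * pi)\<^sup>2)) *
           ((-1) ^ k * (LINT t|lebesgue. h t * cos ((real k + 1/2) * pi * t)))))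
    sums ((LINT t|lebesgue. h t * cos (x * t)) / cos x - (LINT t|lebesgue. h t * cos (y * t)) / cos y)"
proof -
  define a where "a = (\<lambda>k. (real k + 1/2) * pi)"
  define K where "K = (\<lambda>t. cos (x * t) / cos x - cos (y * t) / cos y)"
  define c where "c = (\<lambda>k. 2 * a k * (x + y) / ((x\<^sup>2 - (a k)\<^sup>2) * (y\<^sup>2 - (a k)\<^sup>2)))"
  define b where "b = (\<lambda>k. (x - y) * (c k * (-1) ^ k))"
  have ne: "x\<^sup>2 \<noteq> (a k)\<^sup>2" "y\<^sup>2 \<noteq> (a k)\<^sup>2" for k
    unfolding a_def using cos_nonzero_imp_square_ne cos_nz by blast+
  have cos_a: "cos (a k) = 0" and sin_a: "sin (a k) = (-1) ^ k" for k
    unfolding a_def cos_half_odd_pi sin_half_odd_pi by simp_all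
  have a_pos: "0 < a k" and a_inj: "a i = a j \<longleftrightarrow> i = j" for i j k
    unfolding a_def by (simp_all add: add_nonneg_pos)
  have orth: "integral {0..1} (\<lambda>t. cos (a i * t) * cos (a j * t)) = 0" if "i \<noteq> j" for i j
    using that a_inj a_pos[THEN less_imp_le]
    by (subst integral_cos_mult_cos) (auto intro!: square_ne_of_pos_ne simp: cos_a)
  have nrm: "integral {0..1} (\<lambda>t. cos (a k * t) * cos (a k * t)) = 1 / 2" for k
    using integral_cos_squared[of "a k"] a_pos[of k] by (auto simp: cos_a)
  have rec: "\<exists>i j \<alpha> \<beta>. \<forall>t. cos (pi * t) * cos (a k * t) = \<alpha> * cos (a i * t) + \<beta> * cos (a j * t)" for k
  proof (cases k)
    case 0
    \<comment> \<open>The lower neighbour of the first node \<open>pi / 2\<close> is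
      \<open>- pi / 2\<close>, which evenness of the cosine folds back onto the same basis
      function.\<close>
    have "a k * t + pi * t = a 1 * t" "a k * t - pi * t = - (a 0 * t)" for t
      by (simp_all add: a_def 0 algebra_simps)
    then have "cos (pi * t) * cos (a k * t) = (1/2) * cos (a 1 * t) + (1/2) * cos (a 0 * t)" for t
      using cos_times_cos_expand[of "pi * t" "a k * t"] by simp
    then show ?thesis by blast
  next
    case (Suc m)
    have "a k * t + pi * t = a (k + 1) * t" "a k * t - pi * t = a m * t" for t
      by (simp_all add: a_def Suc algebra_simps)
    then show ?thesis
      using cos_times_cos_expand[of "pi * t" "a k * t" for t] by metis
  qed
  have c_summ: "summable (\<lambda>k. \<bar>c k\<bar>)"
    unfolding c_def
  proof (rule summable_node_coefficients[OF xy])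
    show "real k \<le> a k" for k
      unfolding a_def distrib_right using real_le_mult_pi[of k] pi_gt_zero by linarith
    fix k assume "x \<le> a k" "y \<le> a k"
    then have "2 * a k * (x + y) \<le> 2 * a k * (2 * a k)" using a_pos[of k] by (intro mult_left_mono) auto
    moreover have "0 \<le> 2 * a k * (x + y)" using xy a_pos[of k] by simp
    ultimately show "\<bar>2 * a k * (x + y)\<bar> \<le> 4 * (a k)\<^sup>2"
      by (simp add: power2_eq_square)
  qed
  have summ: "summable (\<lambda>k. \<bar>b k\<bar>)"
    unfolding b_def abs_mult power_abs using c_summ by simp
  have coeff: "integral {0..1} (\<lambda>t. K t * cos (a k * t)) =
      b k * integral {0..1} (\<lambda>t. cos (a k * t) * cos (a k * t))" for k
  proof -
    have "integral {0..1} (\<lambda>t. K t * cos (a k * t)) =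
        integral {0..1} (\<lambda>t. inverse (cos x) * (cos (x * t) * cos (a k * t)) -
          inverse (cos y) * (cos (y * t) * cos (a k * t)))"
      by (simp add: K_def divide_inverse algebra_simps)
    also have "\<dots> = inverse (cos x) * (- (a k * cos x * sin (a k)) / (x\<^sup>2 - (a k)\<^sup>2)) -
        inverse (cos y) * (- (a k * cos y * sin (a k)) / (y\<^sup>2 - (a k)\<^sup>2))"
      by (subst Henstock_Kurzweil_Integration.integral_diff)
         (auto intro!: integrable_continuous_real continuous_intros
           simp: integral_cos_mult_cos[OF ne(1)] integral_cos_mult_cos[OF ne(2)] cos_a)
    also have "\<dots> = - ((-1) ^ k) * a k * (1 / (x\<^sup>2 - (a k)\<^sup>2) - 1 / (y\<^sup>2 - (a k)\<^sup>2))"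
      using cos_nz by (simp add: sin_a field_simps)
    also have "1 / (x\<^sup>2 - (a k)\<^sup>2) - 1 / (y\<^sup>2 - (a k)\<^sup>2) =
        - ((x - y) * (x + y) / ((x\<^sup>2 - (a k)\<^sup>2) * (y\<^sup>2 - (a k)\<^sup>2)))"
      using ne[of k] by (simp add: divide_simps) (simp add: algebra_simps power2_eq_square)
    finally show ?thesis
      by (simp add: nrm b_def c_def)
  qed
  have "cos (a 0 * t) \<noteq> 0" if "t \<in> {0<..<1}" for t
  proof -
    have "0 < cos (a 0 * t)"
      using that by (intro cos_gt_zero) (auto simp: a_def)
    then show ?thesis by simp
  qed
  then have "(\<lambda>k. b k * cos (a k * t)) sums K t" if "t \<in> {0<..<1}" for t
    using that
    by (intro orthogonal_expansion_sums[where e="\<lambda>k t. cos (a k * t)"] orth rec summ coeff)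
       (auto simp: K_def cos_nz intro!: continuous_intros)
  then have "(\<lambda>k. b k * (LINT t|lebesgue. h t * cos (a k * t))) sums (LINT t|lebesgue. h t * K t)"
    by (intro integral_orthogonal_expansion_sums[OF h] supp summ) (auto intro!: continuous_intros)
  also have "(LINT t|lebesgue. h t * K t) =
      (LINT t|lebesgue. h t * cos (x * t)) / cos x - (LINT t|lebesgue. h t * cos (y * t)) / cos y"
    by (simp add: K_def right_diff_distrib integrable_cos integrable_sin)
  finally show ?thesis
    by (simp only: b_def c_def a_def mult_ac)
qed

section \<open>Differentiability and positivity of the transforms\<close>

text \<open>Differentiation under the integral by dominated convergence: \<open>\<kappa>\<close> is
  1-Lipschitz and \<open>\<bar>t\<bar> \<le> 1\<close> where \<open>h\<close> lives, so
  \<open>\<bar>h t\<bar>\<close> dominates all difference quotients.\<close>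

lemma transform_has_real_derivative:
  fixes \<kappa> :: "real \<Rightarrow> real"
  assumes deriv: "\<And>u. (\<kappa> has_real_derivative \<kappa>' u) (at u)"
    and bound: "\<And>u. \<bar>\<kappa> u\<bar> \<le> 1" "\<And>u. \<bar>\<kappa>' u\<bar> \<le> 1"
    and cont: "continuous_on UNIV \<kappa>'"
  shows "((\<lambda>x. LINT t|lebesgue. h t * \<kappa> (x * t)) has_real_derivative
          (LINT t|lebesgue. h t * (t * \<kappa>' (x * t)))) (at x)"
proof -
  note [measurable] = borel_measurable_integrable[OF h]
  have cont_\<kappa>: "continuous_on UNIV \<kappa>"
    using deriv by (auto intro!: continuous_at_imp_continuous_on DERIV_isCont)
  have cont_x: "continuous_on UNIV (\<lambda>t. \<kappa> (z * t))" "continuous_on UNIV (\<lambda>t. \<kappa>' (z * t))" for z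
    by (auto intro!: continuous_on_compose2[OF cont_\<kappa>] continuous_on_compose2[OF cont] continuous_intros)
  have [measurable]: "(\<lambda>t. \<kappa> (z * t)) \<in> borel_measurable lebesgue"
      "(\<lambda>t. \<kappa>' (z * t)) \<in> borel_measurable lebesgue" "(\<lambda>t::real. t) \<in> borel_measurable lebesgue" for z
    using cont_x[of z] by (auto intro!: measurable_completion borel_measurable_continuous_onI)
  have int: "integrable lebesgue (\<lambda>t. h t * \<kappa> (z * t))" for z
    by (rule integrable_mult_bounded[OF cont_x(1) bound(1)])
  have lip: "\<bar>\<kappa> u - \<kappa> v\<bar> \<le> \<bar>u - v\<bar>" for u v
    using field_differentiable_bound[of UNIV \<kappa> \<kappa>' 1 u v] deriv bound by simp
  have "((\<lambda>z. ((LINT t|lebesgue. h t * \<kappa> (z * t)) - (LINT t|lebesgue. h t * \<kappa> (x * t))) / (z - x))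
      \<longlongrightarrow> (LINT t|lebesgue. h t * (t * \<kappa>' (x * t)))) (at x)"
    unfolding tendsto_at_iff_sequentially
  proof safe
    fix X :: "nat \<Rightarrow> real" assume X: "\<forall>i. X i \<in> UNIV - {x}" "X \<longlonglongrightarrow> x"
    then have X_ne: "X i \<noteq> x" for i by auto
    have "(\<lambda>i. LINT t|lebesgue. h t * ((\<kappa> (X i * t) - \<kappa> (x * t)) / (X i - x)))
        \<longlonglongrightarrow> (LINT t|lebesgue. h t * (t * \<kappa>' (x * t)))"
    proof (rule integral_dominated_convergence[where w="\<lambda>t. \<bar>h t\<bar>"])
      show "AE t in lebesgue. (\<lambda>i. h t * ((\<kappa> (X i * t) - \<kappa> (x * t)) / (X i - x)))
          \<longlonglongrightarrow> h t * (t * \<kappa>' (x * t))"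
      proof (rule AE_I2)
        fix t
        have "((\<lambda>z. z * t) has_real_derivative t) (at x)"
          by (auto intro!: derivative_eq_intros)
        from DERIV_chain2[OF deriv this]
        have "((\<lambda>z. \<kappa> (z * t)) has_real_derivative t * \<kappa>' (x * t)) (at x)"
          by (simp add: mult.commute)
        then have "((\<lambda>z. (\<kappa> (z * t) - \<kappa> (x * t)) / (z - x)) \<longlongrightarrow> t * \<kappa>' (x * t)) (at x)"
          unfolding has_field_derivative_iff .
        then have "(\<lambda>i. (\<kappa> (X i * t) - \<kappa> (x * t)) / (X i - x)) \<longlonglongrightarrow> t * \<kappa>' (x * t)"
          using X unfolding tendsto_at_iff_sequentially comp_def by blast
        then show "(\<lambda>i. h t * ((\<kappa> (X i * t) - \<kappa> (x * t)) / (X i - x))) \<longlonglongrightarrow> h t * (t * \<kappa>' (x * t))"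
          by (rule tendsto_mult_left)
      qed
      show "AE t in lebesgue. norm (h t * ((\<kappa> (X i * t) - \<kappa> (x * t)) / (X i - x))) \<le> \<bar>h t\<bar>" for i
      proof (rule AE_I2)
        fix t
        show "norm (h t * ((\<kappa> (X i * t) - \<kappa> (x * t)) / (X i - x))) \<le> \<bar>h t\<bar>"
        proof (cases "t \<in> {0<..<1}")
          case True
          have "\<bar>\<kappa> (X i * t) - \<kappa> (x * t)\<bar> \<le> \<bar>X i - x\<bar> * \<bar>t\<bar>"
            using lip[of "X i * t" "x * t"] by (simp add: left_diff_distrib[symmetric] abs_mult)
          also have "\<dots> \<le> \<bar>X i - x\<bar> * 1"
            using True by (intro mult_left_mono) auto
          finally have "\<bar>(\<kappa> (X i * t) - \<kappa> (x * t)) / (X i - x)\<bar> \<le> 1"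
            using X_ne[of i] by (simp add: abs_divide divide_le_eq)
          from mult_left_mono[OF this, of "\<bar>h t\<bar>"] show ?thesis
            by (simp add: abs_mult)
        qed (simp add: supp)
      qed
    qed (use h in auto)
    also have "(\<lambda>i. LINT t|lebesgue. h t * ((\<kappa> (X i * t) - \<kappa> (x * t)) / (X i - x))) =
        (\<lambda>i. ((LINT t|lebesgue. h t * \<kappa> (X i * t)) - (LINT t|lebesgue. h t * \<kappa> (x * t))) / (X i - x))"
      using int by (simp add: right_diff_distrib diff_divide_distrib)
    finally show "((\<lambda>z. ((LINT t|lebesgue. h t * \<kappa> (z * t)) - (LINT t|lebesgue. h t * \<kappa> (x * t))) / (z - x)) \<circ> X)
        \<longlonglongrightarrow> (LINT t|lebesgue. h t * (t * \<kappa>' (x * t)))"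
      by (simp add: comp_def)
  qed
  then show ?thesis
    unfolding has_field_derivative_iff .
qed

lemma cos_transform_differentiable:
  "\<exists>D. ((\<lambda>x. LINT t|lebesgue. h t * cos (x * t)) has_real_derivative D) (at x)"
  by (rule exI, rule transform_has_real_derivative[where \<kappa>'="\<lambda>u. - sin u"])
     (auto intro!: derivative_eq_intros continuous_intros)

lemma sin_transform_differentiable:
  "\<exists>D. ((\<lambda>x. LINT t|lebesgue. h t * sin (x * t)) has_real_derivative D) (at x)"
  by (rule exI, rule transform_has_real_derivative[where \<kappa>'=cos])
     (auto intro!: derivative_eq_intros continuous_intros)

text \<open>The integral is nonnegative, and if it were zero, the integrand would vanish almost
  everywhere and the unit interval would be a null set.\<close>

lemma integral_mult_pos:
  fixes e :: "real \<Rightarrow> real"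
  assumes pos: "\<And>t. t \<in> {0<..<1} \<Longrightarrow> 0 < h t"
    and e: "continuous_on UNIV e" "\<And>t. \<bar>e t\<bar> \<le> B" "\<And>t. t \<in> {0<..<1} \<Longrightarrow> 0 < e t"
  shows "0 < (LINT t|lebesgue. h t * e t)"
proof -
  have int: "integrable lebesgue (\<lambda>t. h t * e t)"
    by (rule integrable_mult_bounded[OF e(1,2)])
  have he_pos: "0 < h t * e t" if "t \<in> {0<..<1}" for t
    using pos e(3) that by simp
  have nonneg: "0 \<le> h t * e t" for t
    using he_pos[of t] supp[of t] by (cases "t \<in> {0<..<1}") auto
  have "(LINT t|lebesgue. h t * e t) \<noteq> 0"
  proof
    assume "(LINT t|lebesgue. h t * e t) = 0"
    then have "AE t in lebesgue. h t * e t = 0"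
      using integral_nonneg_eq_0_iff_AE[OF int] nonneg by simp
    then have "AE t in lebesgue. t \<notin> {0<..<1::real}"
      by eventually_elim (use he_pos in force)
    then have "{0<..<1::real} \<in> null_sets lebesgue"
      by (subst AE_iff_null_sets) auto
    then show False
      by (simp add: null_sets_def)
  qed
  then show ?thesis
    using Bochner_Integration.integral_nonneg[of lebesgue "\<lambda>t. h t * e t"] nonneg by fastforce
qed

section \<open>At most one zero in each cell\<close>

text \<open>Alternating samples cancel the signs \<open>(-1) ^ k\<close> of the series, so every
  term has the same sign on the cell. \<open>G\<close> is tied to the transform only for positive
  arguments; the sample at \<open>k = 0\<close> is therefore stated for the integral itself.\<close>

lemma cos_transform_zeros_of_integer_signs:
  assumes G: "\<And>x. 0 < x \<Longrightarrow> G x = (LINT t|lebesgue. h t * cos (x * t))"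
    and diff: "\<And>x. 0 < x \<Longrightarrow> \<exists>D. (G has_real_derivative D) (at x)"
    and signs: "\<And>k. 0 < (-1) ^ k * (LINT t|lebesgue. h t * cos (real k * pi * t))"
  shows "at_most_one_zero_simple G {real n * pi<..<(real n + 1) * pi}"
proof -
  let ?I = "{real n * pi<..<(real n + 1) * pi}"
  let ?c = "\<lambda>k x y. (if k = 0 then 1 else 2) * (x * y + (real k * pi)\<^sup>2) /
           ((x\<^sup>2 - (real k * pi)\<^sup>2) * (y\<^sup>2 - (real k * pi)\<^sup>2)) *
           ((-1) ^ k * (LINT t|lebesgue. h t * cos (real k * pi * t)))"
  have I_pos: "0 < x" if "x \<in> ?I" for x
    using that by (auto intro: le_less_trans[rotated])
  have denom: "0 < (x\<^sup>2 - (real k * pi)\<^sup>2) * (y\<^sup>2 - (real k * pi)\<^sup>2)" if "x \<in> ?I" "y \<in> ?I" for x y k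
    using that pi_multiple_notin_cell[of k 0 n]
    by (intro node_product_pos[of "real n * pi" _ "(real n + 1) * pi"]) auto
  have c_pos: "0 < ?c k x y" if "x \<in> ?I" "y \<in> ?I" for k x y
  proof (intro mult_pos_pos[OF divide_pos_pos[OF _ denom[OF that]] signs])
    have "0 < x * y + (real k * pi)\<^sup>2"
      using I_pos that by (intro add_pos_nonneg) auto
    then show "0 < (if k = 0 then 1 else 2) * (x * y + (real k * pi)\<^sup>2)"
      by simp
  qed
  show ?thesis
  \<comment> \<open>The series for \<open>G x / sin x\<close> carries the factor
    \<open>y - x\<close>, so this quotient decreases; dividing by \<open>- sin x\<close> gives the
    required increasing one.\<close>
  proof (rule at_most_one_zero_simple_of_sums[where s="\<lambda>x. - sin x" and c="?c"])
    show "(\<lambda>k. (x - y) * ?c k x y) sums (G x / - sin x - G y / - sin y)"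
      if "x \<in> ?I" "y \<in> ?I" for x y
    proof -
      have swap: "(x - y) * z = - ((y - x) * z)" for z :: real
        by algebra
      have "G x / - sin x - G y / - sin y =
          - ((LINT t|lebesgue. h t * cos (x * t)) / sin x - (LINT t|lebesgue. h t * cos (y * t)) / sin y)"
        using that by (simp add: G I_pos)
      then show ?thesis
        unfolding swap
        by (simp only:, intro sums_minus cos_transform_sampling_integers I_pos that
            sin_nonzero_in_cell[of _ n])
    qed
    show "isCont (\<lambda>x. ?c 0 x y) y" if "y \<in> ?I" for y
      using I_pos[OF that] by (auto intro!: continuous_intros)
    show "0 \<le> ?c k x y" if "x \<in> ?I" "y \<in> ?I" for k x y
      by (rule less_imp_le[OF c_pos[OF that]])
    show "0 < ?c 0 x y" if "x \<in> ?I" "y \<in> ?I" for x y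
      by (rule c_pos[OF that])
  qed (use diff I_pos sin_nonzero_in_cell[of _ n] in \<open>auto intro!: continuous_intros\<close>)
qed

text \<open>The series already carries the factor \<open>x - y\<close>, so the divisor is
  \<open>sin\<close> itself. The leading term \<open>?c 0\<close> comes from the node pi.\<close>

lemma sin_transform_zeros_of_integer_signs:
  assumes G: "\<And>x. 0 < x \<Longrightarrow> G x = (LINT t|lebesgue. h t * sin (x * t))"
    and diff: "\<And>x. 0 < x \<Longrightarrow> \<exists>D. (G has_real_derivative D) (at x)"
    and signs: "\<And>k. 0 < (-1) ^ k * (LINT t|lebesgue. h t * sin (real (Suc k) * pi * t))"
  shows "at_most_one_zero_simple G {real n * pi<..<(real n + 1) * pi}"
proof -
  let ?I = "{real n * pi<..<(real n + 1) * pi}"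
  let ?c = "\<lambda>k x y. 2 * (real (Suc k) * pi) * (x + y) /
           ((x\<^sup>2 - (real (Suc k) * pi)\<^sup>2) * (y\<^sup>2 - (real (Suc k) * pi)\<^sup>2)) *
           ((-1) ^ k * (LINT t|lebesgue. h t * sin (real (Suc k) * pi * t)))"
  have I_pos: "0 < x" if "x \<in> ?I" for x
    using that by (auto intro: le_less_trans[rotated])
  have denom: "0 < (x\<^sup>2 - (real k * pi)\<^sup>2) * (y\<^sup>2 - (real k * pi)\<^sup>2)" if "x \<in> ?I" "y \<in> ?I" for x y k
    using that pi_multiple_notin_cell[of k 0 n]
    by (intro node_product_pos[of "real n * pi" _ "(real n + 1) * pi"]) auto
  have c_pos: "0 < ?c k x y" if "x \<in> ?I" "y \<in> ?I" for k x y
  proof (intro mult_pos_pos[OF divide_pos_pos[OF _ denom[OF that]] signs])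
    have "0 < x + y"
      using I_pos[OF that(1)] I_pos[OF that(2)] by simp
    then show "0 < 2 * (real (Suc k) * pi) * (x + y)"
      by (intro mult_pos_pos) auto
  qed
  show ?thesis
  proof (rule at_most_one_zero_simple_of_sums[where s=sin and c="?c"])
    show "(\<lambda>k. (x - y) * ?c k x y) sums (G x / sin x - G y / sin y)"
      if "x \<in> ?I" "y \<in> ?I" for x y
      unfolding G[OF I_pos[OF that(1)]] G[OF I_pos[OF that(2)]]
      by (intro sin_transform_sampling_integers I_pos that sin_nonzero_in_cell[of _ n])
    show "isCont (\<lambda>x. ?c 0 x y) y" if "y \<in> ?I" for y
      using denom[OF that that, of "Suc 0"] by (auto intro!: continuous_intros)
    show "0 \<le> ?c k x y" if "x \<in> ?I" "y \<in> ?I" for k x y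
      by (rule less_imp_le[OF c_pos[OF that]])
    show "0 < ?c 0 x y" if "x \<in> ?I" "y \<in> ?I" for x y
      by (rule c_pos[OF that])
  qed (use diff I_pos sin_nonzero_in_cell[of _ n] in \<open>auto intro!: continuous_intros\<close>)
qed

text \<open>The same argument with the divisor \<open>cos\<close>. The cells start at
  \<open>pi / 2\<close>; for the functions in question the interval before it is settled by
  positivity of the transform.\<close>

lemma cos_transform_zeros_of_half_integer_signs:
  assumes G: "\<And>x. 0 < x \<Longrightarrow> G x = (LINT t|lebesgue. h t * cos (x * t))"
    and diff: "\<And>x. 0 < x \<Longrightarrow> \<exists>D. (G has_real_derivative D) (at x)"
    and signs: "\<And>k. 0 < (-1) ^ k * (LINT t|lebesgue. h t * cos ((real k + 1/2) * pi * t))"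
  shows "at_most_one_zero_simple G {(real n + 1/2) * pi<..<(real n + 1/2 + 1) * pi}"
proof -
  let ?I = "{(real n + 1/2) * pi<..<(real n + 1/2 + 1) * pi}"
  let ?c = "\<lambda>k x y. 2 * ((real k + 1/2) * pi) * (x + y) /
           ((x\<^sup>2 - ((real k + 1/2) * pi)\<^sup>2) * (y\<^sup>2 - ((real k + 1/2) * pi)\<^sup>2)) *
           ((-1) ^ k * (LINT t|lebesgue. h t * cos ((real k + 1/2) * pi * t)))"
  have I_pos: "0 < x" if "x \<in> ?I" for x
    using that by (auto intro: le_less_trans[rotated])
  have denom: "0 < (x\<^sup>2 - ((real k + 1/2) * pi)\<^sup>2) * (y\<^sup>2 - ((real k + 1/2) * pi)\<^sup>2)"
    if "x \<in> ?I" "y \<in> ?I" for x y k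
    by (intro node_product_pos[OF _ _ pi_multiple_notin_cell[of k "1/2" n]] that) auto
  have c_pos: "0 < ?c k x y" if "x \<in> ?I" "y \<in> ?I" for k x y
  proof (intro mult_pos_pos[OF divide_pos_pos[OF _ denom[OF that]] signs])
    have "0 < x + y"
      using I_pos[OF that(1)] I_pos[OF that(2)] by simp
    then show "0 < 2 * ((real k + 1/2) * pi) * (x + y)"
      by (intro mult_pos_pos) auto
  qed
  show ?thesis
  proof (rule at_most_one_zero_simple_of_sums[where s=cos and c="?c"])
    show "(\<lambda>k. (x - y) * ?c k x y) sums (G x / cos x - G y / cos y)"
      if "x \<in> ?I" "y \<in> ?I" for x y
      unfolding G[OF I_pos[OF that(1)]] G[OF I_pos[OF that(2)]]
      by (intro cos_transform_sampling_half_integers I_pos that cos_nonzero_in_cell[of _ n])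
    show "isCont (\<lambda>x. ?c 0 x y) y" if "y \<in> ?I" for y
      using denom[OF that that, of 0] by (auto intro!: continuous_intros)
    show "0 \<le> ?c k x y" if "x \<in> ?I" "y \<in> ?I" for k x y
      by (rule less_imp_le[OF c_pos[OF that]])
    show "0 < ?c 0 x y" if "x \<in> ?I" "y \<in> ?I" for x y
      by (rule c_pos[OF that])
  qed (use diff I_pos cos_nonzero_in_cell[of _ n] in \<open>auto intro!: continuous_intros\<close>)
qed

end

section \<open>Reflection, signs at the nodes and location of the zeros\<close>

text \<open>The substitution moves the reflection from \<open>f\<close> to the kernel, where the
  addition formulas for \<open>cos (x - x * t)\<close> and \<open>sin (x - x * t)\<close>
  apply.\<close>

lemma LINT_reflect:
  fixes f :: "real \<Rightarrow> real" and g :: "real \<Rightarrow> real"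
  shows "(LINT t:{0<..<1}|lebesgue. f (1 - t) * g t) =
    (LINT t|lebesgue. indicator {0<..<1} t * f t * g (1 - t))"
  unfolding set_lebesgue_integral_def
  by (subst lebesgue_integral_real_affine[where c="-1" and t=1])
     (auto intro!: Bochner_Integration.integral_cong split: split_indicator)

theorem corollary4p1:
  fixes f U V U\<^sub>s V\<^sub>s :: "real \<Rightarrow> real"
  assumes positive: "\<And>t. t \<in> {0<..<1} \<Longrightarrow> f t > 0"
    and general: "general_case f"
    and integrable: "set_integrable lebesgue {0<..<1} f"
    and U: "\<And>x. x > 0 \<Longrightarrow> U x = cos_integral f x"
    and V: "\<And>x. x > 0 \<Longrightarrow> V x = sin_integral f x"
    and U\<^sub>s: "\<And>x. x > 0 \<Longrightarrow> U\<^sub>s x = cos_integral (\<lambda>t. f (1 - t)) x"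
    and V\<^sub>s: "\<And>x. x > 0 \<Longrightarrow> V\<^sub>s x = sin_integral (\<lambda>t. f (1 - t)) x"
  shows
    "((\<forall>x>0. V\<^sub>s x > 0) \<longrightarrow>
       (\<forall>k::nat. k \<ge> 1 \<longrightarrow>
          exactly_one_zero_simple U {(real k - 1/2) * pi<..<(real k + 1/2) * pi} \<and>
          exactly_one_zero_simple V {real k * pi<..<(real k + 1) * pi}) \<and>
       (\<forall>x>0. U x = 0 \<longrightarrow>
          (\<exists>k::nat. k \<ge> 1 \<and> x \<in> {(real k - 1/2) * pi<..<(real k + 1/2) * pi})) \<and>
       (\<forall>x>0. V x = 0 \<longrightarrow>
          (\<exists>k::nat. k \<ge> 1 \<and> x \<in> {real k * pi<..<(real k + 1) * pi})) \<and>
       (\<nexists>x. x > 0 \<and> U x = 0 \<and> V x = 0))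
     \<and>
     ((\<forall>x>0. U\<^sub>s x > 0) \<longrightarrow>
       exactly_one_zero_simple U {pi/2<..<pi} \<and>
       (\<forall>k::nat. k \<ge> 1 \<longrightarrow> exactly_one_zero_simple U {real k * pi<..<(real k + 1) * pi}) \<and>
       (\<exists>x\<in>{pi<..<3 * pi/2}. V x = 0) \<and>
       (\<forall>k::nat. k \<ge> 1 \<longrightarrow>
          (\<exists>x\<in>{(real k + 1/2) * pi<..<(real k + 3/2) * pi}. V x = 0)) \<and>
       (\<forall>x>0. U x = 0 \<longrightarrow>
          x \<in> {pi/2<..<pi} \<or>
          (\<exists>k::nat. k \<ge> 1 \<and> x \<in> {real k * pi<..<(real k + 1) * pi})) \<and>
       (\<forall>x>0. V x = 0 \<longrightarrow>
          x \<in> {pi<..<3 * pi/2} \<or>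
          (\<exists>k::nat. k \<ge> 1 \<and> x \<in> {(real k + 1/2) * pi<..<(real k + 3/2) * pi})) \<and>
       (\<nexists>x. x > 0 \<and> U x = 0 \<and> V x = 0))
     \<and>
     ((\<forall>x>0. V\<^sub>s x > 0) \<and> (\<forall>x>0. U\<^sub>s x > 0) \<longrightarrow>
       (\<forall>k::nat. k \<ge> 1 \<longrightarrow>
          exactly_one_zero_simple U {(real k - 1/2) * pi<..<real k * pi} \<and>
          exactly_one_zero_simple V {real k * pi<..<(real k + 1/2) * pi}) \<and>
       (\<forall>x>0. U x = 0 \<longrightarrow>
          (\<exists>k::nat. k \<ge> 1 \<and> x \<in> {(real k - 1/2) * pi<..<real k * pi})) \<and>
       (\<forall>x>0. V x = 0 \<longrightarrow>
          (\<exists>k::nat. k \<ge> 1 \<and> x \<in> {real k * pi<..<(real k + 1/2) * pi})) \<and>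
       (\<nexists>x. x > 0 \<and> U x = 0 \<and> V x = 0))"
proof -
  \<comment> \<open>Extension of \<open>f\<close> by zero turns set integrals into integrals over
    the whole line, the form of the transform lemmas.\<close>
  define h where "h = (\<lambda>t. indicator {0<..<1} t * f t)"
  define C where "C = (\<lambda>x. LINT t|lebesgue. h t * cos (x * t))"
  define S where "S = (\<lambda>x. LINT t|lebesgue. h t * sin (x * t))"
  have h: "integrable lebesgue h"
    using integrable by (simp add: set_integrable_def h_def)
  have supp: "h t = 0" if "t \<notin> {0<..<1}" for t
    using that by (auto simp: h_def)
  have h_pos: "0 < h t" if "t \<in> {0<..<1}" for t
    using that positive by (simp add: h_def)
  have UC: "U x = C x" and VS: "V x = S x" if "0 < x" for x
    using that by (simp_all add: U V C_def S_def h_def cos_integral_def sin_integral_def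
      set_lebesgue_integral_def mult.assoc)
  note int = integrable_cos[OF h supp] integrable_sin[OF h supp]
  have Us_eq: "U\<^sub>s x = cos x * U x + sin x * V x" if "0 < x" for x
  proof -
    have "U\<^sub>s x = (LINT t|lebesgue. h t * cos (x * (1 - t)))"
      using LINT_reflect[of f "\<lambda>t. cos (x * t)"] that by (simp add: U\<^sub>s cos_integral_def h_def)
    also have "\<dots> = (LINT t|lebesgue. cos x * (h t * cos (x * t)) + sin x * (h t * sin (x * t)))"
      by (simp add: right_diff_distrib cos_diff algebra_simps)
    also have "\<dots> = cos x * C x + sin x * S x"
      using int by (simp add: C_def S_def)
    finally show ?thesis using UC VS that by simp
  qed
  have Vs_eq: "V\<^sub>s x = sin x * U x - cos x * V x" if "0 < x" for x
  proof -
    have "V\<^sub>s x = (LINT t|lebesgue. h t * sin (x * (1 - t)))"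
      using LINT_reflect[of f "\<lambda>t. sin (x * t)"] that by (simp add: V\<^sub>s sin_integral_def h_def)
    also have "\<dots> = (LINT t|lebesgue. sin x * (h t * cos (x * t)) - cos x * (h t * sin (x * t)))"
      by (simp add: right_diff_distrib sin_diff algebra_simps)
    also have "\<dots> = sin x * C x - cos x * S x"
      using int by (simp add: C_def S_def)
    finally show ?thesis using UC VS that by simp
  qed
  have U_diff: "\<exists>D. (U has_real_derivative D) (at x)" if "0 < x" for x
  proof -
    obtain D where "(C has_real_derivative D) (at x)"
      unfolding C_def using cos_transform_differentiable[OF h supp] by blast
    \<comment> \<open>\<open>U\<close> is prescribed on the positive half-line only; this set is
      open, so the derivative of \<open>C\<close> carries over.\<close>
    then have "(U has_real_derivative D) (at x)"
      by (rule has_field_derivative_transform_within_open[where S="{0<..}"]) (use that UC in auto)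
    then show ?thesis ..
  qed
  have V_diff: "\<exists>D. (V has_real_derivative D) (at x)" if "0 < x" for x
  proof -
    obtain D where "(S has_real_derivative D) (at x)"
      unfolding S_def using sin_transform_differentiable[OF h supp] by blast
    then have "(V has_real_derivative D) (at x)"
      by (rule has_field_derivative_transform_within_open[where S="{0<..}"]) (use that VS in auto)
    then show ?thesis ..
  qed
  have U_cont: "isCont U x" and V_cont: "isCont V x" if "0 < x" for x
    using U_diff[OF that] V_diff[OF that] DERIV_isCont by blast+
  \<comment> \<open>The end point \<open>pi / 2\<close> is included because \<open>t < 1\<close>
    keeps \<open>x * t\<close> strictly below it.\<close>
  have U_pos: "0 < U x" if "0 < x" "x \<le> pi / 2" for x
    unfolding UC[OF that(1)] C_def
  proof (rule integral_mult_pos[OF h supp h_pos, where B=1])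
    fix t :: real assume "t \<in> {0<..<1}"
    then have "0 < x * t" "x * t < x" using that by auto
    then show "0 < cos (x * t)" using that by (intro cos_gt_zero) linarith+
  qed (auto intro!: continuous_intros)
  have V_pos: "0 < V x" if "0 < x" "x \<le> pi" for x
    unfolding VS[OF that(1)] S_def
  proof (rule integral_mult_pos[OF h supp h_pos, where B=1])
    fix t :: real assume "t \<in> {0<..<1}"
    then have "0 < x * t" "x * t < x" using that by auto
    then show "0 < sin (x * t)" using that by (intro sin_gt_zero) linarith+
  qed (auto intro!: continuous_intros)
  \<comment> \<open>This is the sample at the node 0, where \<open>U\<close> is not
    prescribed.\<close>
  have C0: "0 < C 0"
    unfolding C_def by (rule integral_mult_pos[OF h supp h_pos, where B=1]) (auto intro!: continuous_intros)

  have common: "\<nexists>x. x > 0 \<and> U x = 0 \<and> V x = 0"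
    if "(\<forall>x>0. V\<^sub>s x > 0) \<or> (\<forall>x>0. U\<^sub>s x > 0)"
  proof
    assume "\<exists>x. x > 0 \<and> U x = 0 \<and> V x = 0"
    then obtain x where "x > 0" "U x = 0" "V x = 0" by blast
    with Us_eq[of x] Vs_eq[of x] that show False by force
  qed

  have half_pos: "0 < (real k + 1/2) * pi" for k
    by simp
  have U_half: "0 < (-1) ^ k * U ((real k + 1/2) * pi)" if "\<forall>x>0. V\<^sub>s x > 0" for k
    using Vs_eq[OF half_pos[of k]] that[rule_format, OF half_pos[of k]]
    unfolding cos_half_odd_pi sin_half_odd_pi by simp
  have V_half: "0 < (-1) ^ k * V ((real k + 1/2) * pi)" if "\<forall>x>0. U\<^sub>s x > 0" for k
    using Us_eq[OF half_pos[of k]] that[rule_format, OF half_pos[of k]]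
    unfolding cos_half_odd_pi sin_half_odd_pi by simp
  have U_int: "0 < (-1) ^ k * U (real k * pi)" if "\<forall>x>0. U\<^sub>s x > 0" "1 \<le> k" for k
  proof -
    have "0 < real k * pi" using that by simp
    from Us_eq[OF this] that(1)[rule_format, OF this] show ?thesis by (simp add: cos_npi sin_npi)
  qed
  \<comment> \<open>At \<open>real (Suc k) * pi\<close> the reflected sine transform is
    \<open>- cos\<close> times \<open>V\<close>, and this minus sign turns
    \<open>(-1) ^ Suc k\<close> into \<open>(-1) ^ k\<close>.\<close>
  have V_int: "0 < (-1) ^ k * V (real (Suc k) * pi)" if "\<forall>x>0. V\<^sub>s x > 0" for k
  proof -
    have "0 < real (Suc k) * pi" by simp
    from Vs_eq[OF this] that[rule_format, OF this] show ?thesis unfolding cos_npi sin_npi by simp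
  qed

  have U_cell: "at_most_one_zero_simple U {(real n + 1/2) * pi<..<(real n + 1/2 + 1) * pi}"
    if "\<forall>x>0. V\<^sub>s x > 0" for n
    using U_half[OF that] UC[OF half_pos]
    by (intro cos_transform_zeros_of_half_integer_signs[OF h supp] U_diff) (simp_all add: UC C_def)
  have V_cell: "at_most_one_zero_simple V {real n * pi<..<(real n + 1) * pi}"
    if "\<forall>x>0. V\<^sub>s x > 0" for n
  proof (intro sin_transform_zeros_of_integer_signs[OF h supp] V_diff)
    show "0 < (-1) ^ k * (LINT t|lebesgue. h t * sin (real (Suc k) * pi * t))" for k
      using V_int[OF that, of k] VS[of "real (Suc k) * pi"] unfolding S_def by simp
  qed (simp_all add: VS S_def)
  have U_cell': "at_most_one_zero_simple U {real n * pi<..<(real n + 1) * pi}"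
    if "\<forall>x>0. U\<^sub>s x > 0" for n
  proof (intro cos_transform_zeros_of_integer_signs[OF h supp] U_diff)
    show "0 < (-1) ^ k * (LINT t|lebesgue. h t * cos (real k * pi * t))" for k
      using U_int[OF that, of k] UC[of "real k * pi"] C0 unfolding C_def by (cases "k = 0") auto
  qed (simp_all add: UC C_def)

  have U_zero_half: "\<exists>k. x \<in> {(real k + 1/2) * pi<..<(real k + 1/2 + 1) * pi}"
    if "\<forall>x>0. V\<^sub>s x > 0" "0 < x" "U x = 0" for x
  proof (rule in_pi_cell)
    show "1/2 * pi < x" using U_pos[of x] that(2,3) by (cases "x \<le> pi / 2") auto
    show "x \<noteq> (real k + 1/2) * pi" for k using U_half[OF that(1), of k] that(3) by auto
  qed
  \<comment> \<open>The first of these cells reaches from \<open>pi / 2\<close> to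
    \<open>3 * pi / 2\<close>; \<open>V_gt_pi\<close> trims it to the part beyond pi.\<close>
  have V_zero_half: "\<exists>k. x \<in> {(real k + 1/2) * pi<..<(real k + 1/2 + 1) * pi}"
    if "\<forall>x>0. U\<^sub>s x > 0" "0 < x" "V x = 0" for x
  proof (rule in_pi_cell)
    show "1/2 * pi < x" using V_pos[of x] that(2,3) pi_gt_zero by (cases "x \<le> pi") linarith+
    show "x \<noteq> (real k + 1/2) * pi" for k using V_half[OF that(1), of k] that(3) by auto
  qed
  have V_gt_pi: "pi < x" if "0 < x" "V x = 0" for x
    using V_pos[of x] that by (cases "x \<le> pi") auto
  \<comment> \<open>The shift is 1 because \<open>V\<close> is positive up to and including
    pi.\<close>
  have V_zero_int: "\<exists>k. x \<in> {(real k + 1) * pi<..<(real k + 1 + 1) * pi}"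
    if "\<forall>x>0. V\<^sub>s x > 0" "0 < x" "V x = 0" for x
  proof (rule in_pi_cell)
    show "1 * pi < x" using V_gt_pi[of x] that by simp
    show "x \<noteq> (real k + 1) * pi" for k using V_int[OF that(1), of k] that(3) by (auto simp: add.commute)
  qed
  have U_zero_int: "\<exists>k. x \<in> {(real k + 0) * pi<..<(real k + 0 + 1) * pi}"
    if "\<forall>x>0. U\<^sub>s x > 0" "0 < x" "U x = 0" for x
  proof (rule in_pi_cell)
    show "0 * pi < x" using that by simp
    show "x \<noteq> (real k + 0) * pi" for k using U_int[OF that(1), of k] that(2,3) by (cases "k = 0") auto
  qed

  have part1: "(\<forall>k::nat. k \<ge> 1 \<longrightarrow>
          exactly_one_zero_simple U {(real k - 1/2) * pi<..<(real k + 1/2) * pi} \<and>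
          exactly_one_zero_simple V {real k * pi<..<(real k + 1) * pi}) \<and>
       (\<forall>x>0. U x = 0 \<longrightarrow>
          (\<exists>k::nat. k \<ge> 1 \<and> x \<in> {(real k - 1/2) * pi<..<(real k + 1/2) * pi})) \<and>
       (\<forall>x>0. V x = 0 \<longrightarrow>
          (\<exists>k::nat. k \<ge> 1 \<and> x \<in> {real k * pi<..<(real k + 1) * pi}))"
    if Vs: "\<forall>x>0. V\<^sub>s x > 0"
  proof (intro conjI allI impI)
    fix k :: nat assume "k \<ge> 1"
    then obtain n where n: "k = Suc n" by (cases k) auto
    have "exactly_one_zero_simple U {(real n + 1/2) * pi<..<(real (Suc n) + 1/2) * pi}"
      using alternating_product_neg[OF U_half[OF Vs, of n] U_half[OF Vs, of "Suc n"]]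
      by (intro exactly_one_zero_simpleI[OF U_cell[OF Vs, of n]] U_cont less_le_trans[OF half_pos[of n]])
         (auto simp: add.commute)
    then show "exactly_one_zero_simple U {(real k - 1/2) * pi<..<(real k + 1/2) * pi}"
      by (simp add: n algebra_simps)
    have n_pos: "0 < real (Suc n) * pi" by simp
    have "exactly_one_zero_simple V {real (Suc n) * pi<..<real (Suc (Suc n)) * pi}"
      using alternating_product_neg[OF V_int[OF Vs, of n] V_int[OF Vs, of "Suc n"]]
      by (intro exactly_one_zero_simpleI[OF V_cell[OF Vs, of "Suc n"]] V_cont less_le_trans[OF n_pos])
         (auto simp: add.commute)
    then show "exactly_one_zero_simple V {real k * pi<..<(real k + 1) * pi}"
      by (simp add: n add.commute)
  next
    fix x assume "0 < x" "U x = 0"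
    from U_zero_half[OF Vs this] obtain k
      where "x \<in> {(real k + 1/2) * pi<..<(real k + 1/2 + 1) * pi}" ..
    then show "\<exists>k::nat. k \<ge> 1 \<and> x \<in> {(real k - 1/2) * pi<..<(real k + 1/2) * pi}"
      by (intro exI[of _ "Suc k"]) (auto simp: algebra_simps)
  next
    fix x assume "0 < x" "V x = 0"
    from V_zero_int[OF Vs this] obtain k
      where "x \<in> {(real k + 1) * pi<..<(real k + 1 + 1) * pi}" ..
    then show "\<exists>k::nat. k \<ge> 1 \<and> x \<in> {real k * pi<..<(real k + 1) * pi}"
      by (intro exI[of _ "Suc k"]) (auto simp: algebra_simps)
  qed
  have part2: "exactly_one_zero_simple U {pi/2<..<pi} \<and>
       (\<forall>k::nat. k \<ge> 1 \<longrightarrow> exactly_one_zero_simple U {real k * pi<..<(real k + 1) * pi}) \<and>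
       (\<exists>x\<in>{pi<..<3 * pi/2}. V x = 0) \<and>
       (\<forall>k::nat. k \<ge> 1 \<longrightarrow>
          (\<exists>x\<in>{(real k + 1/2) * pi<..<(real k + 3/2) * pi}. V x = 0)) \<and>
       (\<forall>x>0. U x = 0 \<longrightarrow>
          x \<in> {pi/2<..<pi} \<or>
          (\<exists>k::nat. k \<ge> 1 \<and> x \<in> {real k * pi<..<(real k + 1) * pi})) \<and>
       (\<forall>x>0. V x = 0 \<longrightarrow>
          x \<in> {pi<..<3 * pi/2} \<or>
          (\<exists>k::nat. k \<ge> 1 \<and> x \<in> {(real k + 1/2) * pi<..<(real k + 3/2) * pi}))"
    if Us: "\<forall>x>0. U\<^sub>s x > 0"
  proof (intro conjI allI impI)
    \<comment> \<open>Uniqueness holds on the whole cell from 0 to pi, and the sign changes between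
      \<open>pi / 2\<close> and pi.\<close>
    show "exactly_one_zero_simple U {pi/2<..<pi}"
      using U_pos[of "pi / 2"] U_int[OF Us, of 1]
      by (intro exactly_one_zero_simpleI[OF U_cell'[OF Us, of 0]] U_cont)
         (auto simp: mult_less_0_iff intro: less_le_trans[OF pi_half_gt_zero])
    fix k :: nat assume k: "k \<ge> 1"
    have k_pos: "0 < real k * pi" using k by simp
    have "U (real k * pi) * U (real (Suc k) * pi) < 0"
      using k by (intro alternating_product_neg[OF U_int[OF Us] U_int[OF Us]]) auto
    then show "exactly_one_zero_simple U {real k * pi<..<(real k + 1) * pi}"
      by (intro exactly_one_zero_simpleI[OF U_cell'[OF Us, of k]] U_cont less_le_trans[OF k_pos])
         (auto simp: add.commute)
    show "\<exists>x\<in>{(real k + 1/2) * pi<..<(real k + 3/2) * pi}. V x = 0"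
    proof (rule zero_of_sign_change)
      show "V ((real k + 1/2) * pi) * V ((real k + 3/2) * pi) < 0"
        using alternating_product_neg[OF V_half[OF Us, of k] V_half[OF Us, of "Suc k"]]
        by (simp add: algebra_simps)
    qed (auto intro!: V_cont less_le_trans[OF half_pos[of k]])
  next
    show "\<exists>x\<in>{pi<..<3 * pi/2}. V x = 0"
      \<comment> \<open>\<open>V\<close> is positive at pi and negative at
        \<open>3 * pi / 2\<close>. Only existence is claimed for \<open>V\<close> in this case, so
        the sign change is enough.\<close>
      using V_pos[of pi] V_half[OF Us, of 1]
      by (intro zero_of_sign_change V_cont)
         (auto simp: mult_less_0_iff intro: less_le_trans[OF pi_gt_zero])
  next
    fix x assume x: "0 < x" "U x = 0"
    from U_zero_int[OF Us this] obtain k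
      where k: "x \<in> {(real k + 0) * pi<..<(real k + 0 + 1) * pi}" ..
    show "x \<in> {pi/2<..<pi} \<or> (\<exists>k::nat. k \<ge> 1 \<and> x \<in> {real k * pi<..<(real k + 1) * pi})"
    proof (cases "k = 0")
      case True
      then show ?thesis using k U_pos[of x] x by (cases "x \<le> pi / 2") auto
    next
      case False
      then show ?thesis using k by (intro disjI2 exI[of _ k]) auto
    qed
  next
    fix x assume x: "0 < x" "V x = 0"
    from V_zero_half[OF Us this] obtain k
      where k: "x \<in> {(real k + 1/2) * pi<..<(real k + 1/2 + 1) * pi}" ..
    show "x \<in> {pi<..<3 * pi/2} \<or>
        (\<exists>k::nat. k \<ge> 1 \<and> x \<in> {(real k + 1/2) * pi<..<(real k + 3/2) * pi})"
    proof (cases "k = 0")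
      case True
      then show ?thesis using k V_gt_pi[OF x] by auto
    next
      case False
      then show ?thesis using k by (intro disjI2 exI[of _ k]) (auto simp: algebra_simps)
    qed
  qed
  have part3: "(\<forall>k::nat. k \<ge> 1 \<longrightarrow>
          exactly_one_zero_simple U {(real k - 1/2) * pi<..<real k * pi} \<and>
          exactly_one_zero_simple V {real k * pi<..<(real k + 1/2) * pi}) \<and>
       (\<forall>x>0. U x = 0 \<longrightarrow>
          (\<exists>k::nat. k \<ge> 1 \<and> x \<in> {(real k - 1/2) * pi<..<real k * pi})) \<and>
       (\<forall>x>0. V x = 0 \<longrightarrow>
          (\<exists>k::nat. k \<ge> 1 \<and> x \<in> {real k * pi<..<(real k + 1/2) * pi}))"
    if Vs: "\<forall>x>0. V\<^sub>s x > 0" and Us: "\<forall>x>0. U\<^sub>s x > 0"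
  proof -
    \<comment> \<open>With both reflected transforms positive, the signs of \<open>U\<close> are
      known at both kinds of nodes, and the change already occurs on the left half of the
      cell.\<close>
    have U1: "exactly_one_zero_simple U {(real n + 1/2) * pi<..<real (Suc n) * pi}" for n
      using alternating_product_neg[OF U_half[OF Vs, of n] U_int[OF Us, of "Suc n"]]
      by (intro exactly_one_zero_simpleI[OF U_cell[OF Vs, of n]] U_cont less_le_trans[OF half_pos[of n]])
         (auto simp: algebra_simps)
    have V1: "exactly_one_zero_simple V {real (Suc n) * pi<..<(real (Suc n) + 1/2) * pi}" for n
    proof -
      have n_pos: "0 < real (Suc n) * pi" by simp
      show ?thesis
        using alternating_product_neg[OF V_int[OF Vs, of n] V_half[OF Us, of "Suc n"]]
        by (intro exactly_one_zero_simpleI[OF V_cell[OF Vs, of "Suc n"]] V_cont less_le_trans[OF n_pos])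
           (auto simp: algebra_simps)
    qed
    show ?thesis
    proof (intro conjI allI impI)
      fix k :: nat assume "k \<ge> 1"
      then obtain n where n: "k = Suc n" by (cases k) auto
      show "exactly_one_zero_simple U {(real k - 1/2) * pi<..<real k * pi}"
        using U1[of n] by (simp add: n algebra_simps)
      show "exactly_one_zero_simple V {real k * pi<..<(real k + 1/2) * pi}"
        using V1[of n] by (simp add: n)
    next
      fix x assume x: "0 < x" "U x = 0"
      from U_zero_half[OF Vs this] obtain k
        where k: "x \<in> {(real k + 1/2) * pi<..<(real k + 1/2 + 1) * pi}" ..
      \<comment> \<open>The half cell contains a zero \<open>z\<close>, and uniqueness on the full
        cell identifies \<open>x\<close> with it.\<close>
      obtain z where z: "z \<in> {(real k + 1/2) * pi<..<real (Suc k) * pi}" "U z = 0"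
        using U1[of k] unfolding exactly_one_zero_simple_def by blast
      then have "z \<in> {(real k + 1/2) * pi<..<(real k + 1/2 + 1) * pi}"
        by (auto simp: algebra_simps)
      then have "x = z"
        using U_cell[OF Vs, of k] k x z unfolding at_most_one_zero_simple_def by blast
      then show "\<exists>k::nat. k \<ge> 1 \<and> x \<in> {(real k - 1/2) * pi<..<real k * pi}"
        using z by (intro exI[of _ "Suc k"]) (auto simp: algebra_simps)
    next
      fix x assume x: "0 < x" "V x = 0"
      from V_zero_int[OF Vs this] obtain k
        where k: "x \<in> {(real k + 1) * pi<..<(real k + 1 + 1) * pi}" ..
      then have k': "x \<in> {real (Suc k) * pi<..<(real (Suc k) + 1) * pi}"
        by (simp add: add.commute)
      obtain z where z: "z \<in> {real (Suc k) * pi<..<(real (Suc k) + 1/2) * pi}" "V z = 0"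
        using V1[of k] unfolding exactly_one_zero_simple_def by blast
      then have "z \<in> {real (Suc k) * pi<..<(real (Suc k) + 1) * pi}"
        by (auto simp: algebra_simps)
      then have "x = z"
        using V_cell[OF Vs, of "Suc k"] k' x z unfolding at_most_one_zero_simple_def by blast
      then show "\<exists>k::nat. k \<ge> 1 \<and> x \<in> {real k * pi<..<(real k + 1/2) * pi}"
        using z by (intro exI[of _ "Suc k"]) auto
    qed
  qed
  show ?thesis
  proof (rule conjI[OF impI conjI[OF impI impI]], goal_cases)
    case 1
    show ?case using part1[OF 1] common[OF disjI1[OF 1]] by (elim conjE) (intro conjI; assumption)
  next
    case 2
    show ?case using part2[OF 2] common[OF disjI2[OF 2]] by (elim conjE) (intro conjI; assumption)
  next
    case 3
    show ?case
      using part3[OF conjunct1[OF 3] conjunct2[OF 3]] common[OF disjI1[OF conjunct1[OF 3]]]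
      by (elim conjE) (intro conjI; assumption)
  qed
qed

end
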